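(* Let $p\ge 2$ be an integer and let $\mathfrak{g}_p$ be the gap-$p$ Virasoro algebra. For a simple $\mathfrak{g}_p$-module $V$, the following statements are equivalent: (1) there exists a positive integer $k$ such that all $L_i$, $i\ge k$, act on $V$ locally finitely; (2) there exists a positive integer $k$ such that all $L_i$, $i\ge k$, act on $V$ locally nilpotently; (3) there exists a positive integer $n$ such that $V$ is a locally finite $\mathfrak{g}_p^{(\ge n)}$-module; (4) there exists a positive integer $n$ such that $V$ is a locally nilpotent $\mathfrak{g}_p^{(\ge n)}$-module; (5) there exist a positive integer $n$ and a nonzero vector $v\in V$ such that $\mathfrak{g}_p^{(\ge n)}v=0$; (6) $V$ is restricted.
   Context: $[\frac p2]$ is the largest integer not exceeding $\frac p2$. The gap-$p$ Virasoro algebra $\mathfrak{g}_p$ is the complex Lie algebra with basis $\{L_m,C_i\mid m\in\mathbb{Z},0\le i\le[\frac p2]\}$ and brackets $$[L_m,L_n]=(n-m)L_{m+n}+\delta_{m+n,0}\tfrac1{12}\Big(\big(\tfrac mp\big)^3-\tfrac mp\Big)C_0,$$ $$[L_m,L_r]=rL_{m+r},\qquad [L_r,L_s]=r\delta_{r+s,0}C_{\widetilde r},\qquad [C_i,\mathfrak{g}_p]=0,$$ for $m,n\in p\mathbb{Z}$, $r,s\notin p\mathbb{Z}$, where $\widetilde r=\min\{\overline r,p-\overline r\}$ and $\overline r$ is the remainder of $r$ on division by $p$. For a positive integer $n$, $\mathfrak{g}_p^{(\ge n)}=\sum_{i\ge n}\mathbb{C}L_i$, a subalgebra of $\mathfrak{g}_p$.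 A $\mathfrak{g}_p$-module $V$ is restricted if for every $v\in V$, $L_kv=0$ for all sufficiently large $k$. Let $V$ be a module over a Lie algebra $\mathfrak{g}$ and $x\in\mathfrak{g}$. The element $x$ is locally nilpotent on $V$ if for every $v\in V$ there is $n\in\mathbb{N}$ with $x^nv=0$, and locally finite on $V$ if $\dim\sum_{i\in\mathbb{N}}\mathbb{C}x^iv<\infty$ for every $v\in V$. $V$ is a locally nilpotent $\mathfrak{g}$-module if for every $v\in V$ there is $n\in\mathbb{N}$ with $\mathfrak{g}^nv=0$, and a locally finite $\mathfrak{g}$-module if $\dim\sum_{i\in\mathbb{N}}\mathfrak{g}^iv<\infty$ for every $v\in V$; here $\mathbb{N}=\{0,1,2,\ldots\}$ and $\mathfrak{g}^iv$ is the span of all $x_1\cdots x_iv$ with $x_1,\ldots,x_i\in\mathfrak{g}$. *)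

theory Defs
  imports Complex_Main "HOL-Library.Poly_Mapping"
begin

section \<open>Lie algebras and their modules\<close>

text \<open>
  A Lie algebra is a subspace \<open>G\<close> of an ambient vector space that is closed under a bracket; the
  axioms are only required on \<open>G\<close>. This way a subalgebra is just a smaller carrier.
\<close>

locale lie_algebra = vector_space sg
  for sg :: "'k::field \<Rightarrow> 'g::ab_group_add \<Rightarrow> 'g"  (* scalar multiplication *)
  and G :: "'g set"
  and br :: "'g \<Rightarrow> 'g \<Rightarrow> 'g" +
  assumes subspace_carrier: "module.subspace sg G"
    and bracket_closed: "\<lbrakk>x \<in> G; y \<in> G\<rbrakk> \<Longrightarrow> br x y \<in> G"
    and bracket_add_left: "\<lbrakk>x \<in> G; y \<in> G; z \<in> G\<rbrakk> \<Longrightarrow> br (x + y) z = br x z + br y z"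
    and bracket_add_right: "\<lbrakk>x \<in> G; y \<in> G; z \<in> G\<rbrakk> \<Longrightarrow> br x (y + z) = br x y + br x z"
    and bracket_scale_left: "\<lbrakk>x \<in> G; y \<in> G\<rbrakk> \<Longrightarrow> br (sg c x) y = sg c (br x y)"
    and bracket_scale_right: "\<lbrakk>x \<in> G; y \<in> G\<rbrakk> \<Longrightarrow> br x (sg c y) = sg c (br x y)"
    and bracket_self: "x \<in> G \<Longrightarrow> br x x = 0"
    and jacobi: "\<lbrakk>x \<in> G; y \<in> G; z \<in> G\<rbrakk> \<Longrightarrow>
      br x (br y z) + br y (br z x) + br z (br x y) = 0"

locale lie_module = lie_algebra sg G br + V: vector_space sv
  for sg :: "'k::field \<Rightarrow> 'g::ab_group_add \<Rightarrow> 'g"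
  and G :: "'g set"
  and br :: "'g \<Rightarrow> 'g \<Rightarrow> 'g"
  and sv :: "'k \<Rightarrow> 'v::ab_group_add \<Rightarrow> 'v"
  and act :: "'g \<Rightarrow> 'v \<Rightarrow> 'v" +
  assumes act_add_left: "\<lbrakk>x \<in> G; y \<in> G\<rbrakk> \<Longrightarrow> act (x + y) v = act x v + act y v"
    and act_scale_left: "x \<in> G \<Longrightarrow> act (sg c x) v = sv c (act x v)"
    and act_add_right: "x \<in> G \<Longrightarrow> act x (v + w) = act x v + act x w"
    and act_scale_right: "x \<in> G \<Longrightarrow> act x (sv c v) = sv c (act x v)"
    and act_bracket: "\<lbrakk>x \<in> G; y \<in> G\<rbrakk> \<Longrightarrow> act (br x y) v = act x (act y v) - act y (act x v)"

locale simple_lie_module = lie_module sg G br sv act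
  for sg :: "'k::field \<Rightarrow> 'g::ab_group_add \<Rightarrow> 'g"
  and G :: "'g set"
  and br :: "'g \<Rightarrow> 'g \<Rightarrow> 'g"
  and sv :: "'k \<Rightarrow> 'v::ab_group_add \<Rightarrow> 'v"
  and act :: "'g \<Rightarrow> 'v \<Rightarrow> 'v" +
  assumes nontrivial: "\<exists>v::'v. v \<noteq> 0"
    and simple: "\<lbrakk>module.subspace sv W; \<And>x w. \<lbrakk>x \<in> G; w \<in> W\<rbrakk> \<Longrightarrow> act x w \<in> W\<rbrakk> \<Longrightarrow>
      W = {0} \<or> W = UNIV"

text \<open>
  The library's \<open>dim\<close> is \<open>0\<close> on infinite-dimensional spaces, so finite dimension is expressed by
  the existence of a finite basis.
\<close>

definition finite_dim :: "('k::field \<Rightarrow> 'v::ab_group_add \<Rightarrow> 'v) \<Rightarrow> 'v set \<Rightarrow> bool" where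
  "finite_dim sv W \<longleftrightarrow> (\<exists>B. finite B \<and> \<not> module.dependent sv B \<and> module.span sv B = W)"

definition elt_locally_nilpotent :: "('g \<Rightarrow> 'v::zero \<Rightarrow> 'v) \<Rightarrow> 'g \<Rightarrow> bool" where
  "elt_locally_nilpotent act x \<longleftrightarrow> (\<forall>v. \<exists>n. (act x ^^ n) v = 0)"

definition elt_locally_finite ::
  "('k::field \<Rightarrow> 'v::ab_group_add \<Rightarrow> 'v) \<Rightarrow> ('g \<Rightarrow> 'v \<Rightarrow> 'v) \<Rightarrow> 'g \<Rightarrow> bool" where
  "elt_locally_finite sv act x \<longleftrightarrow> (\<forall>v. finite_dim sv (module.span sv {(act x ^^ i) v | i. True}))"

text \<open>\<open>lie_pow sv act H i v\<close> is the span of all \<open>x\<^sub>1 \<cdots> x\<^sub>i v\<close> with \<open>x\<^sub>1, \<dots>, x\<^sub>i \<in> H\<close>.\<close>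

definition lie_pow ::
  "('k::field \<Rightarrow> 'v::ab_group_add \<Rightarrow> 'v) \<Rightarrow> ('g \<Rightarrow> 'v \<Rightarrow> 'v) \<Rightarrow> 'g set \<Rightarrow> nat \<Rightarrow> 'v \<Rightarrow> 'v set" where
  "lie_pow sv act H i v =
    module.span sv {foldr act xs v | xs. length xs = i \<and> set xs \<subseteq> H}"

definition locally_nilpotent_module ::
  "('k::field \<Rightarrow> 'v::ab_group_add \<Rightarrow> 'v) \<Rightarrow> ('g \<Rightarrow> 'v \<Rightarrow> 'v) \<Rightarrow> 'g set \<Rightarrow> bool" where
  "locally_nilpotent_module sv act H \<longleftrightarrow> (\<forall>v. \<exists>n. lie_pow sv act H n v = {0})"

definition locally_finite_module ::
  "('k::field \<Rightarrow> 'v::ab_group_add \<Rightarrow> 'v) \<Rightarrow> ('g \<Rightarrow> 'v \<Rightarrow> 'v) \<Rightarrow> 'g set \<Rightarrow> bool" where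
  "locally_finite_module sv act H \<longleftrightarrow>
    (\<forall>v. finite_dim sv (module.span sv (\<Union>i. lie_pow sv act H i v)))"


section \<open>The gap-p Virasoro algebra\<close>

text \<open>
  The ambient space is the complex vector space with basis indexed by \<open>gap_index\<close>; it contains a
  \<open>C\<^sub>i\<close> for every natural \<open>i\<close>, and \<open>gap_virasoro p\<close> cuts out those with \<open>i \<le> p div 2\<close>.
\<close>

datatype gap_index = IdxL int | IdxC nat

type_synonym gap_space = "gap_index \<Rightarrow>\<^sub>0 complex"

definition gap_scale :: "complex \<Rightarrow> gap_space \<Rightarrow> gap_space" where
  "gap_scale c x = Poly_Mapping.map ((*) c) x"

definition gap_L :: "int \<Rightarrow> gap_space" where
  "gap_L m = Poly_Mapping.single (IdxL m) 1"

definition gap_C :: "nat \<Rightarrow> gap_space" where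
  "gap_C i = Poly_Mapping.single (IdxC i) 1"

definition gap_tilde :: "nat \<Rightarrow> int \<Rightarrow> nat" where
  "gap_tilde p r = nat (min (r mod int p) (int p - r mod int p))"

text \<open>
  The case \<open>m \<notin> p\<int>\<close>, \<open>n \<in> p\<int>\<close> is forced by antisymmetry.
\<close>

fun gap_basis_bracket :: "nat \<Rightarrow> gap_index \<Rightarrow> gap_index \<Rightarrow> gap_space" where
  "gap_basis_bracket p (IdxL m) (IdxL n) =
    (if int p dvd m \<and> int p dvd n then
       gap_scale (of_int (n - m)) (gap_L (m + n)) +
       (if m + n = 0
        then gap_scale (1 / 12 * ((of_int m / of_nat p) ^ 3 - of_int m / of_nat p)) (gap_C 0)
        else 0)
     else if int p dvd m then gap_scale (of_int n) (gap_L (m + n))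
     else if int p dvd n then gap_scale (- of_int m) (gap_L (m + n))
     else if m + n = 0 then gap_scale (of_int m) (gap_C (gap_tilde p m))
     else 0)"
| "gap_basis_bracket p (IdxC i) b = 0"
| "gap_basis_bracket p (IdxL m) (IdxC i) = 0"

definition gap_bracket :: "nat \<Rightarrow> gap_space \<Rightarrow> gap_space \<Rightarrow> gap_space" where
  "gap_bracket p x y =
    (\<Sum>a\<in>Poly_Mapping.keys x. \<Sum>b\<in>Poly_Mapping.keys y.
      gap_scale (Poly_Mapping.lookup x a * Poly_Mapping.lookup y b) (gap_basis_bracket p a b))"

definition gap_virasoro :: "nat \<Rightarrow> gap_space set" where
  "gap_virasoro p =
    module.span gap_scale ({gap_L m | m. True} \<union> {gap_C i | i. i \<le> p div 2})"

definition gap_virasoro_ge :: "int \<Rightarrow> gap_space set" where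
  "gap_virasoro_ge n = module.span gap_scale {gap_L i | i. i \<ge> n}"

definition restricted_module :: "(gap_space \<Rightarrow> 'v::zero \<Rightarrow> 'v) \<Rightarrow> bool" where
  "restricted_module act \<longleftrightarrow> (\<forall>v. \<exists>N. \<forall>k\<ge>N. act (gap_L k) v = 0)"


section \<open>The gap-p Virasoro algebra is a Lie algebra\<close>

lemma lookup_gap_scale [simp]:
  "Poly_Mapping.lookup (gap_scale c x) k = c * Poly_Mapping.lookup x k"
  by (auto simp: gap_scale_def Poly_Mapping.map.rep_eq when_def)

global_interpretation gap: vector_space gap_scale
  by unfold_locales (auto intro!: poly_mapping_eqI simp: lookup_add algebra_simps)

lemma gap_bracket_superset:
  assumes "finite A" "finite B" "Poly_Mapping.keys x \<subseteq> A" "Poly_Mapping.keys y \<subseteq> B"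
  shows "gap_bracket p x y = (\<Sum>a\<in>A. \<Sum>b\<in>B.
      gap_scale (Poly_Mapping.lookup x a * Poly_Mapping.lookup y b) (gap_basis_bracket p a b))"
proof -
  have "(\<Sum>b\<in>B. gap_scale (Poly_Mapping.lookup x a * Poly_Mapping.lookup y b) (gap_basis_bracket p a b))
     = (\<Sum>b\<in>Poly_Mapping.keys y.
      gap_scale (Poly_Mapping.lookup x a * Poly_Mapping.lookup y b) (gap_basis_bracket p a b))" for a
    by (rule sum.mono_neutral_right) (use assms in \<open>auto simp: in_keys_iff\<close>)
  moreover have "(\<Sum>a\<in>A. \<Sum>b\<in>Poly_Mapping.keys y.
      gap_scale (Poly_Mapping.lookup x a * Poly_Mapping.lookup y b) (gap_basis_bracket p a b))
    = gap_bracket p x y"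
    unfolding gap_bracket_def
    by (rule sum.mono_neutral_right) (use assms in \<open>auto simp: in_keys_iff\<close>)
  ultimately show ?thesis by simp
qed

lemma gap_bracket_add_left: "gap_bracket p (x + y) z = gap_bracket p x z + gap_bracket p y z"
proof -
  let ?A = "Poly_Mapping.keys x \<union> Poly_Mapping.keys y" and ?B = "Poly_Mapping.keys z"
  have "Poly_Mapping.keys (x + y) \<subseteq> ?A" by (rule keys_add)
  then show ?thesis
    by (simp add: gap_bracket_superset[of ?A ?B] lookup_add distrib_right gap.scale_left_distrib
        sum.distrib)
qed

lemma gap_bracket_add_right: "gap_bracket p x (y + z) = gap_bracket p x y + gap_bracket p x z"
proof -
  let ?A = "Poly_Mapping.keys y \<union> Poly_Mapping.keys z" and ?B = "Poly_Mapping.keys x"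
  have "Poly_Mapping.keys (y + z) \<subseteq> ?A" by (rule keys_add)
  then show ?thesis
    by (simp add: gap_bracket_superset[of ?B ?A] lookup_add distrib_left gap.scale_left_distrib
        sum.distrib)
qed

lemma keys_gap_scale: "Poly_Mapping.keys (gap_scale c x) \<subseteq> Poly_Mapping.keys x"
  by (auto simp: in_keys_iff)

lemma gap_bracket_scale_left: "gap_bracket p (gap_scale c x) y = gap_scale c (gap_bracket p x y)"
  using keys_gap_scale[of c x]
  by (simp add: gap_bracket_superset[of "Poly_Mapping.keys x" "Poly_Mapping.keys y"]
      gap.scale_sum_right mult.assoc)

lemma gap_bracket_scale_right: "gap_bracket p x (gap_scale c y) = gap_scale c (gap_bracket p x y)"
  using keys_gap_scale[of c y]
  by (simp add: gap_bracket_superset[of "Poly_Mapping.keys x" "Poly_Mapping.keys y"]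
      gap.scale_sum_right mult.left_commute)

lemma gap_bracket_zero [simp]: "gap_bracket p 0 x = 0" "gap_bracket p x 0 = 0"
  by (simp_all add: gap_bracket_def)

lemma gap_bracket_single:
  "gap_bracket p (Poly_Mapping.single a 1) (Poly_Mapping.single b 1) = gap_basis_bracket p a b"
  by (simp add: gap_bracket_def)

lemma gap_bracket_LL: "gap_bracket p (gap_L m) (gap_L n) = gap_basis_bracket p (IdxL m) (IdxL n)"
  by (simp add: gap_L_def gap_bracket_single)

lemma gap_basis_bracket_C_right [simp]: "gap_basis_bracket p b (IdxC i) = 0"
  by (cases b) auto

lemma gap_space_decompose:
  "x = (\<Sum>a\<in>Poly_Mapping.keys x. gap_scale (Poly_Mapping.lookup x a) (Poly_Mapping.single a 1))"
proof (rule poly_mapping_eqI)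
  fix k
  show "Poly_Mapping.lookup x k = Poly_Mapping.lookup
    (\<Sum>a\<in>Poly_Mapping.keys x. gap_scale (Poly_Mapping.lookup x a) (Poly_Mapping.single a 1)) k"
    by (cases "k \<in> Poly_Mapping.keys x")
      (auto simp: lookup_sum lookup_single when_def in_keys_iff if_distrib[of "(*) _"] cong: if_cong)
qed

lemma gap_bracket_C [simp]:
  "gap_bracket p (gap_C i) x = 0" "gap_bracket p x (gap_C i) = 0"
  by (simp_all add: gap_bracket_def gap_C_def)

lemma gap_space_induct [case_names zero add scale L C]:
  assumes "P 0" "\<And>x y. P x \<Longrightarrow> P y \<Longrightarrow> P (x + y)" "\<And>c x. P x \<Longrightarrow> P (gap_scale c x)"
    "\<And>m. P (gap_L m)" "\<And>i. P (gap_C i)"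
  shows "P x"
proof -
  have single: "P (Poly_Mapping.single a 1)" for a
    using assms(4,5) by (cases a) (auto simp: gap_L_def gap_C_def)
  have "P (\<Sum>a\<in>A. gap_scale (Poly_Mapping.lookup x a) (Poly_Mapping.single a 1))" if "finite A" for A
    using that by induction (auto intro: assms single)
  from this[OF finite_keys] show ?thesis by (subst gap_space_decompose)
qed

lemma gap_tilde_minus:
  assumes "p > 0" "\<not> int p dvd m"
  shows "gap_tilde p (- m) = gap_tilde p m"
  using assms by (simp add: gap_tilde_def zmod_zminus1_eq_if dvd_eq_mod_eq_0 min.commute)

lemma gap_tilde_le: "p > 0 \<Longrightarrow> gap_tilde p m \<le> p div 2"
  unfolding gap_tilde_def by linarith

lemma gap_tilde_cong: "int p dvd a \<Longrightarrow> gap_tilde p (a + m) = gap_tilde p m"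
  by (auto simp: gap_tilde_def dvd_def)

lemma gap_bracket_antisym:
  assumes "p > 0"
  shows "gap_bracket p x y = - gap_bracket p y x"
proof (induction x rule: gap_space_induct)
  case (L m)
  show ?case
  proof (induction y rule: gap_space_induct)
    case (L n)
    consider (a) "int p dvd m" "int p dvd n" | (b) "int p dvd m" "\<not> int p dvd n"
      | (c) "\<not> int p dvd m" "int p dvd n" | (d) "\<not> int p dvd m" "\<not> int p dvd n" by blast
    then show ?case
    proof cases
      case d
      show ?thesis
      proof (cases "m + n = 0")
        case True
        then have "n = - m" by simp
        then show ?thesis using d gap_tilde_minus[OF assms, of m]
          by (simp add: gap_bracket_LL)
      qed (use d in \<open>auto simp: gap_bracket_LL add.commute\<close>)
    next
      case a
      show ?thesis
      proof (cases "m + n = 0")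
        case True
        then have "n = - m" by simp
        then show ?thesis using a
          by (auto intro!: poly_mapping_eqI simp: gap_bracket_LL lookup_add algebra_simps)
      qed (use a in \<open>auto intro!: poly_mapping_eqI simp: gap_bracket_LL algebra_simps\<close>)
    qed (auto simp: gap_bracket_LL add.commute)
  qed (auto simp: gap_bracket_add_left gap_bracket_add_right gap_bracket_scale_left
      gap_bracket_scale_right)
qed (auto simp: gap_bracket_add_left gap_bracket_add_right gap_bracket_scale_left
      gap_bracket_scale_right)

lemma gap_bracket_self:
  assumes "p > 0"
  shows "gap_bracket p x x = 0"
proof (rule poly_mapping_eqI)
  fix k
  have "Poly_Mapping.lookup (gap_bracket p x x) k = - Poly_Mapping.lookup (gap_bracket p x x) k"
    by (metis gap_bracket_antisym[OF assms] lookup_uminus)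
  then show "Poly_Mapping.lookup (gap_bracket p x x) k = Poly_Mapping.lookup 0 k" by simp
qed

definition gap_jacobiator :: "nat \<Rightarrow> gap_space \<Rightarrow> gap_space \<Rightarrow> gap_space \<Rightarrow> gap_space" where
  "gap_jacobiator p x y z = gap_bracket p x (gap_bracket p y z) +
    gap_bracket p y (gap_bracket p z x) + gap_bracket p z (gap_bracket p x y)"

lemma gap_bracket_minus:
  "gap_bracket p (- x) y = - gap_bracket p x y" "gap_bracket p x (- y) = - gap_bracket p x y"
  using gap_bracket_add_left[of p x "- x" y] gap_bracket_add_right[of p x y "- y"]
  by (simp_all add: eq_neg_iff_add_eq_0 add.commute)

lemma gap_bracket_diff:
  "gap_bracket p (x - x') y = gap_bracket p x y - gap_bracket p x' y"
  "gap_bracket p x (y - y') = gap_bracket p x y - gap_bracket p x y'"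
  using gap_bracket_add_left[of p x "- x'" y] gap_bracket_add_right[of p x y "- y'"]
  by (simp_all add: gap_bracket_minus)

lemmas gap_bilinear = gap_bracket_add_left gap_bracket_add_right gap_bracket_scale_left
      gap_bracket_scale_right gap_bracket_minus gap_bracket_diff

lemma gap_jacobiator_rotate: "gap_jacobiator p x y z = gap_jacobiator p y z x"
  by (simp add: gap_jacobiator_def algebra_simps)

lemma gap_jacobi_L_0:
  assumes "int p dvd a" "int p dvd b" "int p dvd c" "p > 0"
  shows "gap_jacobiator p (gap_L a) (gap_L b) (gap_L c) = 0"
proof (cases "a + b + c = 0")
  case True
  then have c: "c = - a - b" by simp
  have "int p dvd - a - b" using assms c by simp
  then show ?thesis unfolding c gap_jacobiator_def
    using assms(1,2,4)
    by (auto intro!: poly_mapping_eqI simp: gap_bracket_LL gap_bilinear lookup_add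
       gap_L_def[symmetric] lookup_single when_def field_simps power3_eq_cube)
next
  case False
  then have "b + c + a \<noteq> 0" "c + a + b \<noteq> 0" "a + (b + c) \<noteq> 0" "b + (c + a) \<noteq> 0" "c + (a + b) \<noteq> 0"
    by auto
  then show ?thesis unfolding gap_jacobiator_def
    using assms
    by (auto intro!: poly_mapping_eqI simp: gap_bracket_LL gap_bilinear lookup_add
       algebra_simps)
qed

lemma gap_jacobi_L_1:
  assumes "int p dvd a" "int p dvd b" "\<not> int p dvd c" "p > 0"
  shows "gap_jacobiator p (gap_L a) (gap_L b) (gap_L c) = 0"
  unfolding gap_jacobiator_def using assms
  by (auto intro!: poly_mapping_eqI simp: gap_bracket_LL gap_bilinear lookup_add
       dvd_add_right_iff dvd_add_left_iff algebra_simps)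

lemma gap_jacobi_L_2:
  assumes "int p dvd a" "\<not> int p dvd b" "\<not> int p dvd c" "p > 0"
  shows "gap_jacobiator p (gap_L a) (gap_L b) (gap_L c) = 0"
proof (cases "a + b + c = 0")
  case True
  then have c: "c = - (a + b)" by simp
  have "gap_tilde p c = gap_tilde p b"
    using gap_tilde_minus[of p "a + b"] gap_tilde_cong[of p a b] assms
    unfolding c by (simp add: dvd_add_right_iff)
  then show ?thesis unfolding gap_jacobiator_def using assms True
    by (auto intro!: poly_mapping_eqI simp: gap_bracket_LL gap_bilinear lookup_add
       dvd_add_right_iff dvd_add_left_iff algebra_simps)
next
  case False
  then show ?thesis unfolding gap_jacobiator_def using assms
    by (auto intro!: poly_mapping_eqI simp: gap_bracket_LL gap_bilinear lookup_add
       dvd_add_right_iff dvd_add_left_iff algebra_simps)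
qed

lemma gap_jacobi_L_3:
  assumes "\<not> int p dvd a" "\<not> int p dvd b" "\<not> int p dvd c"
  shows "gap_jacobiator p (gap_L a) (gap_L b) (gap_L c) = 0"
  unfolding gap_jacobiator_def using assms
  by (auto simp: gap_bracket_LL gap_bilinear)

lemma gap_jacobi_L:
  assumes "p > 0"
  shows "gap_jacobiator p (gap_L a) (gap_L b) (gap_L c) = 0"
  using gap_jacobi_L_0 gap_jacobi_L_1 gap_jacobi_L_2 gap_jacobi_L_3 assms
  by (metis gap_jacobiator_rotate)

lemma gap_jacobi:
  assumes "p > 0"
  shows "gap_jacobiator p x y z = 0"
proof (induction x rule: gap_space_induct)
  case (L a)
  show ?case
  proof (induction y rule: gap_space_induct)
    case (L b)
    show ?case
    proof (induction z rule: gap_space_induct)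
      case (L c)
      show ?case using gap_jacobi_L[OF assms] .
    next
      case (add x y)
      have "gap_jacobiator p (gap_L a) (gap_L b) (x + y) =
        gap_jacobiator p (gap_L a) (gap_L b) x + gap_jacobiator p (gap_L a) (gap_L b) y"
        by (simp add: gap_jacobiator_def gap_bilinear)
      with add show ?case by simp
    qed (simp_all add: gap_jacobiator_def gap_bilinear flip: gap.scale_right_distrib)
  next
    case (add x y)
    have "gap_jacobiator p (gap_L a) (x + y) z =
      gap_jacobiator p (gap_L a) x z + gap_jacobiator p (gap_L a) y z"
      by (simp add: gap_jacobiator_def gap_bilinear)
    with add show ?case by simp
  qed (simp_all add: gap_jacobiator_def gap_bilinear flip: gap.scale_right_distrib)
next
  case (add x x')
  have "gap_jacobiator p (x + x') y z = gap_jacobiator p x y z + gap_jacobiator p x' y z"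
    by (simp add: gap_jacobiator_def gap_bilinear)
  with add show ?case by simp
qed (simp_all add: gap_jacobiator_def gap_bilinear flip: gap.scale_right_distrib)

lemma gap_bracket_span_closed:
  assumes "\<And>x y. x \<in> A \<Longrightarrow> y \<in> A \<Longrightarrow> gap_bracket p x y \<in> gap.span A"
    and "x \<in> gap.span A" "y \<in> gap.span A"
  shows "gap_bracket p x y \<in> gap.span A"
  using assms(2)
proof (induction rule: gap.span_induct_alt)
  case (step c a x)
  have "gap_bracket p a y \<in> gap.span A"
    using assms(3)
  proof (induction rule: gap.span_induct_alt)
    case (step d b y)
    then show ?case using assms(1)[OF \<open>a \<in> A\<close>, of b]
      by (simp add: gap_bilinear gap.span_add gap.span_scale)
  qed (simp add: gap.span_zero)
  with step show ?case by (simp add: gap_bilinear gap.span_add gap.span_scale)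
qed (simp add: gap.span_zero)

lemma gap_lie_algebraI:
  assumes "p > 0" "\<And>x y. x \<in> A \<Longrightarrow> y \<in> A \<Longrightarrow> gap_bracket p x y \<in> gap.span A"
  shows "lie_algebra gap_scale (gap.span A) (gap_bracket p)"
  using gap_jacobi[OF assms(1)] gap_bracket_self[OF assms(1)]
    gap_bracket_span_closed[of A p, OF assms(2)]
  by unfold_locales (auto simp: gap_jacobiator_def gap_bilinear)

theorem lie_algebra_gap_virasoro:
  assumes "p > 0"
  shows "lie_algebra gap_scale (gap_virasoro p) (gap_bracket p)"
  unfolding gap_virasoro_def
proof (rule gap_lie_algebraI[OF assms])
  let ?A = "{gap_L m | m. True} \<union> {gap_C i | i. i \<le> p div 2}"
  have L: "gap_scale c (gap_L m) \<in> gap.span ?A" for c m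
    by (rule gap.span_scale[OF gap.span_base]) auto
  have C: "i \<le> p div 2 \<Longrightarrow> gap_scale c (gap_C i) \<in> gap.span ?A" for c i
    by (rule gap.span_scale[OF gap.span_base]) auto
  fix x y assume "x \<in> ?A" "y \<in> ?A"
  then show "gap_bracket p x y \<in> gap.span ?A"
    using L C gap_tilde_le[OF assms]
    by (auto simp: gap_bracket_LL gap.span_zero intro!: gap.span_add gap.span_neg)
qed

theorem lie_algebra_gap_virasoro_ge:
  assumes "p > 0" "n > 0"
  shows "lie_algebra gap_scale (gap_virasoro_ge n) (gap_bracket p)"
  unfolding gap_virasoro_ge_def
proof (rule gap_lie_algebraI[OF assms(1)])
  let ?A = "{gap_L i | i. i \<ge> n}"
  have L: "m \<ge> n \<Longrightarrow> gap_scale c (gap_L m) \<in> gap.span ?A" for c m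
    by (rule gap.span_scale[OF gap.span_base]) auto
  fix x y assume "x \<in> ?A" "y \<in> ?A"
  then show "gap_bracket p x y \<in> gap.span ?A"
    using L assms(2) by (auto simp: gap_bracket_LL gap.span_zero intro!: gap.span_neg)
qed

lemma gap_virasoro_ge_subset: "gap_virasoro_ge n \<subseteq> gap_virasoro p"
  unfolding gap_virasoro_def gap_virasoro_ge_def by (rule gap.span_mono) auto

end

theory Submission
  imports Defs "HOL-Computational_Algebra.Fundamental_Theorem_Algebra"
begin

text \<open>
  Most implications are formal. Write \<open>g\<^sub>n\<close> for the span of the \<open>L i\<close> with \<open>i \<ge> n\<close>. A nonzero vector
  killed by \<open>g\<^sub>n\<close> makes a simple module restricted (\<open>restricted_if_annihilated\<close>), because being killed
  by all late \<open>L k\<close> defines a submodule. It also makes \<open>g\<^sub>n\<close>, for the same \<open>n\<close>, locally nilpotent on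
  the whole module: applying \<open>L a\<close> with \<open>a < n\<close> to a vector that dies after \<open>N\<close> steps delays its death by at most
  \<open>n - a\<close> steps (\<open>L_killed\<close>), since commuting \<open>L i\<close>, \<open>i \<ge> n\<close>, past \<open>L a\<close> raises the index \<open>a\<close>. As each
  vector of a restricted module is killed by all but finitely many of the spanning \<open>L i\<close>, local
  nilpotency of \<open>g\<^sub>n\<close> makes orbits finite-dimensional (\<open>orbit_of_killed_finite\<close>). Conversely, a last nonzero
  product in a locally nilpotent module is annihilated.

  The substance is that local finiteness of all late \<open>L i\<close> yields an annihilated vector
  (\<open>annihilated_if_locally_finite\<close>). It is easy to find a vector whose annihilator in
  \<open>g\<^sub>n\<close> has finite codimension, but a subalgebra of finite codimension need not contain any \<open>g\<^sub>m\<close>. The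
  argument therefore compares growth rates. Take \<open>q > 0\<close>
  divisible by \<open>p\<close> and an eigenvector \<open>w\<close> of \<open>L (2 * q)\<close> with eigenvalue \<open>\<mu>\<close>. The vectors
  \<open>L (r + 2 * q * j) w\<close> are reached in two ways. Applying \<open>ad (L (2 * q))\<close> to \<open>L r\<close> \<open>j\<close> times shows that
  \<open>(L (2 * q) - \<mu>)\<^sup>j (L r w) = b\<^sub>j L (r + 2 * q * j) w\<close>, where \<open>b\<^sub>j\<close> grows like \<open>(2 * q)\<^sup>j j!\<close>.
  Applying \<open>ad (L q)\<close> \<open>2 * j\<close> times gives \<open>c\<^sub>j L (r + 2 * q * j) w\<close>, where \<open>c\<^sub>j\<close> grows like
  \<open>q\<^bsup>2j\<^esup> (2 * j)!\<close>. When \<open>L q\<close> is locally finite, its iterated commutators grow at most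
  exponentially (\<open>iterated_commutator_growth\<close>). Since \<open>c\<^sub>j \<ge> j! b\<^sub>j\<close> (\<open>str_prod_double\<close>), every coordinate
  of \<open>(L (2 * q) - \<mu>)\<^sup>j (L r w)\<close> decays like \<open>K\<^sup>j / j!\<close>. Powers of a locally finite operator decay so
  fast only if they are eventually zero (\<open>nilpotent_if_factorial_decay\<close>), for otherwise a nonzero
  eigenvalue would contribute geometric growth. Hence \<open>L (r + 2 * q * j) w = 0\<close> for large \<open>j\<close>, and
  finitely many \<open>r\<close> cover all late indices.
\<close>

section \<open>Polynomials in an operator\<close>

locale complex_vector_space = vector_space sv
  for sv :: "complex \<Rightarrow> 'v::ab_group_add \<Rightarrow> 'v"
begin

abbreviation endo :: "('v \<Rightarrow> 'v) \<Rightarrow> bool" where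
  "endo A \<equiv> module_hom sv sv A"

abbreviation functional :: "('v \<Rightarrow> complex) \<Rightarrow> bool" where
  "functional \<phi> \<equiv> module_hom sv (*) \<phi>"

lemma endoI:
  assumes "\<And>v w. A (v + w) = A v + A w" "\<And>c v. A (sv c v) = sv c (A v)"
  shows "endo A"
  using assms by (auto simp: module_hom_iff module_axioms)

lemma endo_ident: "endo (\<lambda>v. v)"
  by (rule endoI) simp_all

lemma endo_funpow: "endo A \<Longrightarrow> endo (A ^^ n)"
  by (induction n) (auto simp: module_hom_iff module_axioms)

lemma functional_endo: "functional \<phi> \<Longrightarrow> endo A \<Longrightarrow> functional (\<lambda>v. \<phi> (A v))"
  by (auto simp: module_hom_iff)

text \<open>
  The module carries no norm, so growth is measured after applying linear functionals; this loses
  nothing because a coordinate with respect to a suitable basis detects any nonzero vector.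
\<close>

lemma functionals_separate:
  assumes "v \<noteq> 0"
  obtains \<phi> where "functional \<phi>" "\<phi> v \<noteq> 0"
proof
  let ?B = "extend_basis {v}"
  have ind: "independent {v}" using assms by simp
  note B = independent_extend_basis[OF ind] span_extend_basis[OF ind] extend_basis_superset[OF ind]
  have "module ((*) :: complex \<Rightarrow> _)" by unfold_locales (auto simp: algebra_simps)
  then show "functional (\<lambda>x. representation ?B x v)"
    using B by (auto simp: module_hom_iff module_axioms representation_add representation_scale)
  show "representation ?B v v \<noteq> 0"
    using representation_basis[OF B(1), of v] B(3) by simp
qed

definition poly_apply :: "('v \<Rightarrow> 'v) \<Rightarrow> complex poly \<Rightarrow> 'v \<Rightarrow> 'v" where
  "poly_apply A P v = (\<Sum>i\<le>degree P. sv (coeff P i) ((A ^^ i) v))"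

lemma poly_apply_superset:
  "degree P \<le> n \<Longrightarrow> poly_apply A P v = (\<Sum>i\<le>n. sv (coeff P i) ((A ^^ i) v))"
  unfolding poly_apply_def by (rule sum.mono_neutral_left) (auto simp: coeff_eq_0)

lemma poly_apply_0 [simp]: "poly_apply A 0 v = 0"
  by (simp add: poly_apply_def)

lemma poly_apply_smult: "poly_apply A (smult c P) v = sv c (poly_apply A P v)"
  by (simp add: poly_apply_superset[of _ "degree P"] scale_sum_right)

lemma poly_apply_add: "poly_apply A (P + Q) v = poly_apply A P v + poly_apply A Q v"
  by (simp add: poly_apply_superset[of _ "max (degree P) (degree Q)"] degree_add_le
      scale_left_distrib sum.distrib)

lemma poly_apply_pCons:
  assumes "endo A"
  shows "poly_apply A (pCons a P) v = sv a v + A (poly_apply A P v)"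
proof -
  interpret A: module_hom sv sv A by fact
  have "poly_apply A (pCons a P) v = (\<Sum>i\<le>Suc (degree P). sv (coeff (pCons a P) i) ((A ^^ i) v))"
    by (rule poly_apply_superset) (rule degree_pCons_le)
  also have "\<dots> = sv a v + (\<Sum>i\<le>degree P. sv (coeff P i) (A ((A ^^ i) v)))"
    by (simp add: sum.atMost_Suc_shift del: sum.atMost_Suc)
  finally show ?thesis by (simp add: poly_apply_def A.sum A.scale)
qed

lemma poly_apply_linear_factor:
  assumes "endo A"
  shows "poly_apply A ([:- \<mu>, 1:] * P) v = A (poly_apply A P v) - sv \<mu> (poly_apply A P v)"
  using poly_apply_add[of A "smult (- \<mu>) P" "pCons 0 P" v] poly_apply_smult[of A "- \<mu>" P v] assms
  by (simp add: poly_apply_pCons)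

lemma poly_apply_monom_mult:
  "poly_apply A (monom 1 n * P) v = poly_apply A P ((A ^^ n) v)"
proof -
  have *: "poly_apply A (pCons 0 P) v = poly_apply A P (A v)" for P v
    using poly_apply_superset[OF degree_pCons_le[of 0 P], of A v]
    by (simp add: poly_apply_def[of A P] sum.atMost_Suc_shift funpow_swap1 del: sum.atMost_Suc)
  show ?thesis
    by (induction n arbitrary: v) (simp_all add: monom_Suc * funpow_swap1)
qed

definition algebraic_at :: "('v \<Rightarrow> 'v) \<Rightarrow> 'v \<Rightarrow> bool" where
  "algebraic_at A v \<longleftrightarrow> (\<exists>P. P \<noteq> 0 \<and> poly_apply A P v = 0)"

text \<open>
  If no \<open>A\<^sup>n v\<close> were a combination of its predecessors, the orbit would contain independent sets of
  every size.
\<close>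

lemma algebraic_at_if_finite_span:
  assumes "finite B" "\<And>i. (A ^^ i) v \<in> span B"
  shows "algebraic_at A v"
proof -
  let ?S = "\<lambda>n. (\<lambda>i. (A ^^ i) v) ` {..<n}"
  have "\<exists>n. (A ^^ n) v \<in> span (?S n)"
  proof (rule ccontr)
    assume none: "\<not> ?thesis"
    have "independent (?S n) \<and> card (?S n) = n" for n
    proof (induction n)
      case (Suc n)
      have "(A ^^ n) v \<notin> ?S n" using none span_base[of "(A ^^ n) v" "?S n"] by blast
      then show ?case using Suc none
        by (simp add: lessThan_Suc independent_insert)
    qed (simp add: independent_empty)
    from this[of "Suc (card B)"] independent_span_bound[OF assms(1), of "?S (Suc (card B))"]
    show False using assms(2) by fastforce
  qed
  then obtain n where n: "(A ^^ n) v \<in> span (?S n)" ..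
  have "\<exists>Q. (\<forall>i\<ge>n. coeff Q i = 0) \<and> x = poly_apply A Q v" if "x \<in> span (?S n)" for x
    using that
  proof (induction rule: span_induct_alt)
    case base
    show ?case by (rule exI[of _ 0]) simp
  next
    case (step c x y)
    then obtain Q i where Q: "\<forall>i\<ge>n. coeff Q i = 0" "y = poly_apply A Q v"
      and i: "i < n" "x = (A ^^ i) v" by auto
    have "poly_apply A (monom c i) v = sv c x"
      using i poly_apply_superset[of "monom c i" i] degree_monom_le[of c i]
      by (simp add: if_distrib[of "\<lambda>c. sv c _"] coeff_monom cong: if_cong)
    then show ?case using Q i
      by (intro exI[of _ "monom c i + Q"]) (simp add: poly_apply_add)
  qed
  from this[OF n] obtain Q where Q: "\<forall>i\<ge>n. coeff Q i = 0" "(A ^^ n) v = poly_apply A Q v"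
    by blast
  have "poly_apply A (monom 1 n) v = (A ^^ n) v"
    using poly_apply_superset[of "monom 1 n" n] degree_monom_le[of "1::complex" n]
    by (simp add: if_distrib[of "\<lambda>c. sv c _"] coeff_monom cong: if_cong)
  then have "poly_apply A (monom 1 n + smult (- 1) Q) v = 0"
    using Q by (simp only: poly_apply_add poly_apply_smult) simp
  moreover have "coeff (monom 1 n + smult (- 1) Q) n = 1" using Q by simp
  then have "monom 1 n + smult (- 1) Q \<noteq> 0" by (metis coeff_0 zero_neq_one)
  ultimately show ?thesis unfolding algebraic_at_def by blast
qed

text \<open>
  If \<open>P\<close> annihilates \<open>v\<close> for \<open>A\<close>, then \<open>P(X + c)\<close> annihilates \<open>v\<close> for \<open>A - c\<close>.
\<close>

lemma algebraic_at_shift: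
  assumes "endo A" "algebraic_at A v"
  shows "algebraic_at (\<lambda>x. A x - sv c x) v"
proof -
  interpret A: module_hom sv sv A by fact
  let ?A = "\<lambda>x. A x - sv c x"
  have hom: "endo ?A"
    by (intro endoI) (auto simp: A.add A.scale scale_right_distrib scale_right_diff_distrib mult.commute)
  obtain P where P: "P \<noteq> 0" "poly_apply A P v = 0" using assms(2) by (auto simp: algebraic_at_def)
  have "poly_apply ?A (pcompose P [:c, 1:]) v = poly_apply A P v"
  proof (induction P)
    case (pCons a P)
    have "poly_apply ?A (pcompose (pCons a P) [:c, 1:]) v =
      sv a v + poly_apply ?A ([:- (- c), 1:] * pcompose P [:c, 1:]) v"
      using poly_apply_pCons[OF hom, of a 0 v]
      by (simp only: pcompose_pCons poly_apply_add)
         (simp add: module_hom.zero[OF hom])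
    then show ?case using pCons
      by (simp only: poly_apply_linear_factor[OF hom] poly_apply_pCons[OF assms(1)]) simp
  qed simp
  moreover have "pcompose P [:c, 1:] \<noteq> 0"
    using P(1) by (simp add: pcompose_eq_0_iff)
  ultimately show ?thesis using P(2) unfolding algebraic_at_def by metis
qed

text \<open>
  Strip linear factors off \<open>P\<close> until what is left no longer kills \<open>v\<close>; the last factor stripped
  provides the eigenvalue. That the eigenvalue is a root of \<open>P\<close> allows zero to be
  excluded, and that the eigenvector is a polynomial in \<open>A\<close> applied to \<open>v\<close> transfers estimates from the
  orbit of \<open>v\<close> to it.
\<close>

lemma eigenvector_at_root:
  assumes "endo A" "P \<noteq> 0" "poly_apply A P v = 0" "v \<noteq> 0"
  obtains Q \<mu> where "poly P \<mu> = 0" "poly_apply A Q v \<noteq> 0"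
    "A (poly_apply A Q v) = sv \<mu> (poly_apply A Q v)"
proof -
  have "\<exists>Q \<mu>. poly P \<mu> = 0 \<and> poly_apply A Q v \<noteq> 0 \<and> A (poly_apply A Q v) = sv \<mu> (poly_apply A Q v)"
    using assms(2,3)
  proof (induction "degree P" arbitrary: P rule: less_induct)
    case less
    have "degree P \<noteq> 0"
    proof
      assume "degree P = 0"
      then obtain a where "P = [:a:]" by (metis degree_eq_zeroE)
      with less.prems assms(4) show False by (simp add: poly_apply_def)
    qed
    then obtain \<mu> where \<mu>: "poly P \<mu> = 0"
      using fundamental_theorem_of_algebra[of P] by (auto simp: constant_degree)
    then obtain Q where Q: "P = [:- \<mu>, 1:] * Q" by (metis dvdE poly_eq_0_iff_dvd)
    show ?case
    proof (cases "poly_apply A Q v = 0")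
      case True
      have "Q \<noteq> 0" using less.prems(1) Q by auto
      then have "degree Q < degree P" unfolding Q by (subst degree_mult_eq) auto
      from less.hyps[OF this \<open>Q \<noteq> 0\<close> True] show ?thesis unfolding Q by fastforce
    next
      case False
      moreover have "A (poly_apply A Q v) = sv \<mu> (poly_apply A Q v)"
        using less.prems(2) unfolding Q poly_apply_linear_factor[OF assms(1)] by simp
      ultimately show ?thesis using \<mu> by blast
    qed
  qed
  then show thesis using that by blast
qed

section \<open>Growth of orbits and of iterated commutators\<close>

text \<open>
  The orbit satisfies the linear recurrence given by an annihilating polynomial, so it grows at most
  geometrically. The rate \<open>R\<close> and the number \<open>d\<close> of initial values depend only on \<open>A\<close> and \<open>v\<close>. This
  uniformity in the functional is needed for the two-parameter
  bound in the next lemma, where the functional itself varies.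
\<close>

lemma orbit_growth:
  assumes "endo A" "algebraic_at A v"
  obtains R d where "R \<ge> (1::real)"
    "\<And>\<psi> C i. \<lbrakk>functional \<psi>; C \<ge> 0; \<And>l. l < d \<Longrightarrow> cmod (\<psi> ((A ^^ l) v)) \<le> C\<rbrakk>
      \<Longrightarrow> cmod (\<psi> ((A ^^ i) v)) \<le> C * R ^ i"
proof -
  obtain P where P: "P \<noteq> 0" "poly_apply A P v = 0"
    using assms(2) by (auto simp: algebraic_at_def)
  define d where "d = degree P"
  \<comment> \<open>Normalising \<open>P\<close> expresses \<open>A\<^sup>d v\<close> through the earlier orbit vectors.\<close>
  define a where "a l = coeff P l / lead_coeff P" for l
  define R where "R = 1 + (\<Sum>l<d. cmod (a l))"
  have R: "R \<ge> 1" "(\<Sum>l<d. cmod (a l)) \<le> R" unfolding R_def by (auto intro: sum_nonneg)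
  have "(\<Sum>l<d. sv (coeff P l) ((A ^^ l) v)) + sv (lead_coeff P) ((A ^^ d) v) = 0"
    using P(2) by (simp add: poly_apply_def d_def flip: lessThan_Suc_atMost)
  then have "sv (1 / lead_coeff P) ((\<Sum>l<d. sv (coeff P l) ((A ^^ l) v))
      + sv (lead_coeff P) ((A ^^ d) v)) = 0" by simp
  then have top: "(A ^^ d) v = - (\<Sum>l<d. sv (a l) ((A ^^ l) v))"
    using P(1) by (simp add: scale_right_distrib scale_sum_right a_def eq_neg_iff_add_eq_0
        add.commute)
  show thesis
  proof (rule that[OF R(1), of d])
    fix \<psi> C i
    assume \<psi>: "functional \<psi>" and C: "C \<ge> 0" and init: "\<And>l. l < d \<Longrightarrow> cmod (\<psi> ((A ^^ l) v)) \<le> C"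
    interpret \<psi>: module_hom sv "(*)" \<psi> by fact
    show "cmod (\<psi> ((A ^^ i) v)) \<le> C * R ^ i"
    proof (induction i rule: less_induct)
      case (less i)
      show ?case
      proof (cases "i < d")
        case True
        have "C * 1 \<le> C * R ^ i" using C R(1) by (intro mult_left_mono) auto
        with init[OF True] show ?thesis by simp
      next
        case False
        then obtain m where i: "i = m + d" by (metis le_add_diff_inverse2 not_less)
        interpret Am: module_hom sv sv "A ^^ m" by (rule endo_funpow) fact
        have "(A ^^ i) v = - (\<Sum>l<d. sv (a l) ((A ^^ (m + l)) v))"
          by (simp add: i funpow_add top Am.neg Am.sum Am.scale)
        then have "cmod (\<psi> ((A ^^ i) v)) = cmod (\<Sum>l<d. a l * \<psi> ((A ^^ (m + l)) v))"
          by (simp add: \<psi>.neg \<psi>.sum \<psi>.scale)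
        also have "\<dots> \<le> (\<Sum>l<d. cmod (a l) * (C * R ^ i / R))"
        proof (rule sum_norm_le)
          fix l assume "l \<in> {..<d}"
          then have l: "Suc (m + l) \<le> i" using i by auto
          have "C * R ^ (m + l) * R \<le> C * R ^ i"
            using power_increasing[OF l R(1)] C by (simp add: mult_left_mono mult.commute mult.left_commute)
          then have "C * R ^ (m + l) \<le> C * R ^ i / R" using R(1) by (simp add: field_simps)
          with less[of "m + l"] l have "cmod (\<psi> ((A ^^ (m + l)) v)) \<le> C * R ^ i / R" by simp
          then show "cmod (a l * \<psi> ((A ^^ (m + l)) v)) \<le> cmod (a l) * (C * R ^ i / R)"
            unfolding norm_mult by (rule mult_left_mono) simp
        qed
        also have "\<dots> = (\<Sum>l<d. cmod (a l)) * (C * R ^ i / R)"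
          by (rule sum_distrib_right[symmetric])
        also have "\<dots> \<le> R * (C * R ^ i / R)"
          using R C by (intro mult_right_mono) auto
        finally show ?thesis using R(1) by simp
      qed
    qed
  qed
qed

text \<open>
  Expanding \<open>T j = (ad A)\<^sup>j (T 0)\<close> gives a sum of
  \<open>2\<^sup>j\<close> terms, up to sign of the form \<open>A\<^sup>m (T 0) A\<^sup>i\<close> with \<open>m + i = j\<close>. Each is
  geometrically bounded: in \<open>i\<close> by the recurrence for the orbit of \<open>w\<close>, which leaves only finitely
  many vectors \<open>T 0 (A\<^sup>l w)\<close> whose orbits need to be bounded in \<open>m\<close>.
\<close>

lemma iterated_commutator_growth:
  fixes T :: "nat \<Rightarrow> 'v \<Rightarrow> 'v"
  assumes A: "endo A" "\<And>v. algebraic_at A v" and T0: "endo (T 0)"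
    and comm: "\<And>j v. T (Suc j) v = A (T j v) - T j (A v)"
    and \<phi>: "functional \<phi>"
  obtains C Q where "C \<ge> 0" "\<And>j. cmod (\<phi> (T j w)) \<le> C * Q ^ j"
proof -
  obtain R d where R: "R \<ge> (1::real)" and growR:
    "\<And>\<psi> C i. \<lbrakk>functional \<psi>; C \<ge> 0; \<And>l. l < d \<Longrightarrow> cmod (\<psi> ((A ^^ l) w)) \<le> C\<rbrakk>
      \<Longrightarrow> cmod (\<psi> ((A ^^ i) w)) \<le> C * R ^ i"
    using orbit_growth[OF A(1) A(2)] by metis
  have "\<exists>C S. C \<ge> 0 \<and> S \<ge> 1 \<and> (\<forall>m. cmod (\<phi> ((A ^^ m) z)) \<le> C * S ^ m)" for z
  proof -
    obtain S e where S: "S \<ge> (1::real)" and grow: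
      "\<And>\<psi> C i. \<lbrakk>functional \<psi>; C \<ge> 0; \<And>l. l < e \<Longrightarrow> cmod (\<psi> ((A ^^ l) z)) \<le> C\<rbrakk>
        \<Longrightarrow> cmod (\<psi> ((A ^^ i) z)) \<le> C * S ^ i"
      using orbit_growth[OF A(1) A(2)] by metis
    let ?C = "\<Sum>l<e. cmod (\<phi> ((A ^^ l) z))"
    have "?C \<ge> 0" by (rule sum_nonneg) simp
    moreover have "cmod (\<phi> ((A ^^ l) z)) \<le> ?C" if "l < e" for l
      by (rule member_le_sum) (use that in auto)
    ultimately show ?thesis using grow[OF \<phi>, of ?C] S by blast
  qed
  then obtain C S where CS: "\<And>z. C z \<ge> 0" "\<And>z. S z \<ge> (1::real)"
    "\<And>z m. cmod (\<phi> ((A ^^ m) z)) \<le> C z * S z ^ m" by metis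
  let ?z = "\<lambda>l. T 0 ((A ^^ l) w)"
  define C' S' where "C' = (\<Sum>l<d. C (?z l))" and "S' = 1 + (\<Sum>l<d. S (?z l))"
  have S0: "S z \<ge> 0" for z using CS(2)[of z] by linarith
  have C': "C' \<ge> 0" and S': "S' \<ge> 0" unfolding C'_def S'_def
    using CS(1) S0 by (auto intro!: sum_nonneg add_nonneg_nonneg)
  have base: "cmod (\<phi> ((A ^^ m) (T 0 ((A ^^ i) w)))) \<le> C' * S' ^ m * R ^ i" for m i
  proof (rule growR[of "\<lambda>x. \<phi> ((A ^^ m) (T 0 x))"])
    show "functional (\<lambda>x. \<phi> ((A ^^ m) (T 0 x)))"
      using functional_endo[OF functional_endo[OF \<phi> endo_funpow[OF A(1)]] T0] .
    show "C' * S' ^ m \<ge> 0" using C' S' by simp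
    fix l assume l: "l < d"
    have "C (?z l) \<le> C'" unfolding C'_def by (rule member_le_sum) (use l CS in auto)
    moreover have "S (?z l) \<le> (\<Sum>l<d. S (?z l))" by (rule member_le_sum) (use l S0 in auto)
    then have "S (?z l) ^ m \<le> S' ^ m" unfolding S'_def by (intro power_mono) (use S0 in auto)
    ultimately have "C (?z l) * S (?z l) ^ m \<le> C' * S' ^ m"
      using CS(1) S0 C' by (intro mult_mono) auto
    then show "cmod (\<phi> ((A ^^ m) (T 0 ((A ^^ l) w)))) \<le> C' * S' ^ m"
      using CS(3)[of m "?z l"] by linarith
  qed
  interpret \<phi>: module_hom sv "(*)" \<phi> by fact
  have "cmod (\<phi> ((A ^^ m) (T j ((A ^^ i) w)))) \<le> C' * S' ^ m * R ^ i * (S' + R) ^ j" for m i j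
  proof (induction j arbitrary: m i)
    case (Suc j)
    interpret Am: module_hom sv sv "A ^^ m" by (rule endo_funpow) fact
    have "\<phi> ((A ^^ m) (T (Suc j) ((A ^^ i) w))) =
      \<phi> ((A ^^ Suc m) (T j ((A ^^ i) w))) - \<phi> ((A ^^ m) (T j ((A ^^ Suc i) w)))"
      by (simp add: comm Am.diff \<phi>.diff funpow_swap1)
    then have "cmod (\<phi> ((A ^^ m) (T (Suc j) ((A ^^ i) w)))) \<le>
      cmod (\<phi> ((A ^^ Suc m) (T j ((A ^^ i) w)))) + cmod (\<phi> ((A ^^ m) (T j ((A ^^ Suc i) w))))"
      by (simp only: norm_triangle_ineq4)
    also have "\<dots> \<le> C' * S' ^ Suc m * R ^ i * (S' + R) ^ j + C' * S' ^ m * R ^ Suc i * (S' + R) ^ j"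
      by (intro add_mono Suc.IH)
    also have "\<dots> = C' * S' ^ m * R ^ i * (S' + R) ^ Suc j" by (simp add: algebra_simps)
    finally show ?case .
  qed (use base in auto)
  from this[of 0 _ 0] C' show thesis by (intro that[of C' "S' + R"]) auto
qed

text \<open>
  Were the orbit never zero, it would span an eigenvector \<open>z\<close> with eigenvalue \<open>\<mu> \<noteq> 0\<close>. The decay
  of the orbit of \<open>v\<close> passes to the orbit \<open>\<mu>\<^sup>j z\<close>, which is impossible.
\<close>

lemma nilpotent_if_factorial_decay:
  assumes A: "endo A" "algebraic_at A v"
    and decay: "\<And>\<phi>. functional \<phi> \<Longrightarrow>
      \<exists>C\<ge>0. \<exists>Q. \<forall>j. fact j * cmod (\<phi> ((A ^^ j) v)) \<le> C * Q ^ j"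
  shows "\<exists>n. (A ^^ n) v = 0"
proof (rule ccontr)
  assume not_nil: "\<nexists>n. (A ^^ n) v = 0"
  obtain P where P: "P \<noteq> 0" "poly_apply A P v = 0"
    using A(2) by (auto simp: algebraic_at_def)
  \<comment> \<open>The part of \<open>P\<close> without root \<open>0\<close> acts on a late orbit vector, where it can only see nonzero eigenvalues.\<close>
  obtain P' where P': "P = [:- 0, 1:] ^ order 0 P * P'" "\<not> [:- 0, 1:] dvd P'"
    using order_decomp[OF P(1)] by blast
  let ?v = "(A ^^ order 0 P) v"
  have v': "poly_apply A P' ?v = 0" "poly P' 0 \<noteq> 0" "?v \<noteq> 0"
    using P(2) P' poly_apply_monom_mult[of A "order 0 P" P' v] not_nil
    by (simp_all add: monom_altdef poly_eq_0_iff_dvd)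
  then have "P' \<noteq> 0" by auto
  then obtain Q \<mu> where root: "poly P' \<mu> = 0" and Q: "poly_apply A Q ?v \<noteq> 0"
    "A (poly_apply A Q ?v) = sv \<mu> (poly_apply A Q ?v)"
    by (rule eigenvector_at_root[OF A(1) _ v'(1,3)])
  have \<mu>: "\<mu> \<noteq> 0" using root v'(2) by auto
  define z where "z = poly_apply A (monom 1 (order 0 P) * Q) v"
  have z: "z \<noteq> 0" "A z = sv \<mu> z"
    using Q unfolding z_def poly_apply_monom_mult by auto
  interpret A: module_hom sv sv A by fact
  have eig: "(A ^^ j) z = sv (\<mu> ^ j) z" for j
    by (induction j) (auto simp: A.scale z(2) mult.commute)
  obtain \<phi> where \<phi>: "functional \<phi>" "\<phi> z \<noteq> 0" using functionals_separate[OF z(1)] .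
  interpret \<phi>: module_hom sv "(*)" \<phi> by fact
  obtain C K where C: "C \<ge> 0" and CK: "\<And>j. fact j * cmod (\<phi> ((A ^^ j) v)) \<le> C * K ^ j"
    using decay[OF \<phi>(1)] by metis
  \<comment> \<open>The decay of the orbit of \<open>v\<close> is inherited by every polynomial in \<open>A\<close> applied to \<open>v\<close>, in particular by \<open>z\<close>.\<close>
  have "\<exists>C\<ge>0. \<forall>j. fact j * cmod (\<phi> ((A ^^ j) (poly_apply A F v))) \<le> C * \<bar>K\<bar> ^ j" for F
  proof (induction F)
    case 0
    show ?case
      by (rule exI[of _ 0]) (use A in \<open>auto simp: module_hom.zero[OF endo_funpow] \<phi>.zero\<close>)
  next
    case (pCons a F)
    then obtain D where D: "D \<ge> 0"
      "\<And>j. fact j * cmod (\<phi> ((A ^^ j) (poly_apply A F v))) \<le> D * \<bar>K\<bar> ^ j" by blast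
    have "fact j * cmod (\<phi> ((A ^^ j) (poly_apply A (pCons a F) v))) \<le>
      (cmod a * C + D * \<bar>K\<bar>) * \<bar>K\<bar> ^ j" for j
    proof -
      interpret Aj: module_hom sv sv "A ^^ j" by (rule endo_funpow) fact
      have "cmod (\<phi> ((A ^^ j) (poly_apply A (pCons a F) v))) =
        cmod (a * \<phi> ((A ^^ j) v) + \<phi> ((A ^^ Suc j) (poly_apply A F v)))"
        by (simp add: poly_apply_pCons[OF A(1)] Aj.add Aj.scale \<phi>.add \<phi>.scale funpow_swap1)
      also have "\<dots> \<le> cmod a * cmod (\<phi> ((A ^^ j) v)) + cmod (\<phi> ((A ^^ Suc j) (poly_apply A F v)))"
        by (metis norm_triangle_ineq norm_mult)
      finally have "fact j * cmod (\<phi> ((A ^^ j) (poly_apply A (pCons a F) v))) \<le>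
        fact j * (cmod a * cmod (\<phi> ((A ^^ j) v)) + cmod (\<phi> ((A ^^ Suc j) (poly_apply A F v))))"
        by (rule mult_left_mono) simp
      also have "\<dots> = cmod a * (fact j * cmod (\<phi> ((A ^^ j) v)))
          + fact j * cmod (\<phi> ((A ^^ Suc j) (poly_apply A F v)))" by (simp add: algebra_simps)
      also have "\<dots> \<le> cmod a * (C * \<bar>K\<bar> ^ j) + D * \<bar>K\<bar> ^ Suc j"
      proof (intro add_mono mult_left_mono)
        show "fact j * cmod (\<phi> ((A ^^ j) v)) \<le> C * \<bar>K\<bar> ^ j"
          using CK[of j] mult_left_mono[OF abs_ge_self[of "K ^ j"] C] by (simp add: power_abs)
        have "fact j * cmod (\<phi> ((A ^^ Suc j) (poly_apply A F v))) \<le>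
          fact (Suc j) * cmod (\<phi> ((A ^^ Suc j) (poly_apply A F v)))"
          by (intro mult_right_mono fact_mono) auto
        with D(2)[of "Suc j"]
        show "fact j * cmod (\<phi> ((A ^^ Suc j) (poly_apply A F v))) \<le> D * \<bar>K\<bar> ^ Suc j" by linarith
      qed simp
      finally show ?thesis by (simp add: algebra_simps)
    qed
    then show ?case using C D(1) by (intro exI[of _ "cmod a * C + D * \<bar>K\<bar>"]) auto
  qed
  then obtain D where "D \<ge> 0" and "\<And>j. fact j * cmod (\<phi> ((A ^^ j) z)) \<le> D * \<bar>K\<bar> ^ j"
    unfolding z_def by blast
  then have "cmod (\<phi> z) * fact j * cmod \<mu> ^ j \<le> D * \<bar>K\<bar> ^ j" for j
    using \<open>\<And>j. fact j * cmod (\<phi> ((A ^^ j) z)) \<le> D * \<bar>K\<bar> ^ j\<close>[of j]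
    by (simp add: eig \<phi>.scale norm_mult norm_power mult_ac)
  then have "cmod (\<phi> z) \<le> D * (inverse (fact j) * (\<bar>K\<bar> / cmod \<mu>) ^ j)" for j
    using \<mu> by (simp add: field_simps power_divide)
  moreover have "(\<lambda>j. D * (inverse (fact j) * (\<bar>K\<bar> / cmod \<mu>) ^ j)) \<longlonglongrightarrow> D * 0"
    using summable_LIMSEQ_zero[OF summable_exp] by (intro tendsto_mult tendsto_const)
  ultimately have "cmod (\<phi> z) \<le> 0"
    by (intro LIMSEQ_le_const[of "\<lambda>j. D * (inverse (fact j) * (\<bar>K\<bar> / cmod \<mu>) ^ j)"]) auto
  with \<phi>(2) show False by simp
qed

section \<open>Finite-dimensional spans\<close>

lemma finite_dim_spanI:
  assumes "finite B" "S \<subseteq> span B"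
  shows "finite_dim sv (span S)"
proof -
  obtain D where D: "D \<subseteq> S" "independent D" "S \<subseteq> span D"
    using maximal_independent_subset by blast
  have "finite D" using independent_span_bound[OF assms(1) D(2)] D(1) assms(2) by auto
  moreover have "span D = span S"
    using D(1,3) by (metis span_mono span_span subset_antisym)
  ultimately show ?thesis using D(2) unfolding finite_dim_def by blast
qed

end

section \<open>Simple modules over the gap-p Virasoro algebra\<close>

locale simple_gap_module = simple_lie_module gap_scale "gap_virasoro p" "gap_bracket p" sv act
  for p :: nat and sv :: "complex \<Rightarrow> 'v::ab_group_add \<Rightarrow> 'v" and act :: "gap_space \<Rightarrow> 'v \<Rightarrow> 'v" +
  assumes p_pos: "p > 0"
begin

sublocale V: complex_vector_space sv ..

abbreviation L :: "int \<Rightarrow> 'v \<Rightarrow> 'v" where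
  "L n \<equiv> act (gap_L n)"

abbreviation C :: "nat \<Rightarrow> 'v \<Rightarrow> 'v" where
  "C j \<equiv> act (gap_C j)"

lemma gap_L_mem [simp]: "gap_L n \<in> gap_virasoro p"
  unfolding gap_virasoro_def by (rule gap.span_base) auto

lemma gap_C_mem [simp]: "j \<le> p div 2 \<Longrightarrow> gap_C j \<in> gap_virasoro p"
  unfolding gap_virasoro_def by (rule gap.span_base) auto

lemma endo_act: "x \<in> gap_virasoro p \<Longrightarrow> V.endo (act x)"
  by (rule V.endoI) (auto simp: act_add_right act_scale_right)

lemma act_0 [simp]: "act 0 v = 0"
  using act_scale_left[OF gap_L_mem, of 0 0 v] by simp

lemma act_0_right [simp]: "x \<in> gap_virasoro p \<Longrightarrow> act x 0 = 0"
  using module_hom.zero[OF endo_act] .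

text \<open>
  A uniform shape of all four cases of the bracket: a multiple of \<open>L (m + n)\<close> plus a central term that
  occurs only for \<open>m + n = 0\<close>. It is all that the formal implications use of the structure
  constants.
\<close>

lemma basis_bracket_form:
  "\<exists>c d j. j \<le> p div 2 \<and> (m + n \<noteq> 0 \<longrightarrow> d = 0) \<and>
    gap_bracket p (gap_L m) (gap_L n) = gap_scale c (gap_L (m + n)) + gap_scale d (gap_C j)"
proof -
  consider (a) "int p dvd m" "int p dvd n" | (b) "int p dvd m" "\<not> int p dvd n"
    | (c) "\<not> int p dvd m" "int p dvd n" | (d) "\<not> int p dvd m" "\<not> int p dvd n" by blast
  then show ?thesis
  proof cases
    case a
    then show ?thesis
      by (intro exI[of _ "of_int (n - m)"] exI[of _ 0]
          exI[of _ "if m + n = 0 then 1 / 12 * ((of_int m / of_nat p) ^ 3 - of_int m / of_nat p) else 0"])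
        (simp add: gap_bracket_LL)
  next
    case b
    then show ?thesis
      by (intro exI[of _ "of_int n"] exI[of _ 0]) (simp add: gap_bracket_LL)
  next
    case c
    then show ?thesis
      by (intro exI[of _ "- of_int m"] exI[of _ 0]) (simp add: gap_bracket_LL)
  next
    case d
    then show ?thesis using gap_tilde_le[OF p_pos, of m]
      by (intro exI[of _ 0] exI[of _ "if m + n = 0 then of_int m else 0"] exI[of _ "gap_tilde p m"])
        (simp add: gap_bracket_LL)
  qed
qed

lemma L_commutation:
  obtains c d j where "j \<le> p div 2" "m + n \<noteq> 0 \<Longrightarrow> d = 0"
    "\<And>v. L m (L n v) = L n (L m v) + sv c (L (m + n) v) + sv d (C j v)"
proof -
  obtain c d j where j: "j \<le> p div 2" and d: "m + n \<noteq> 0 \<longrightarrow> d = 0" and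
    br: "gap_bracket p (gap_L m) (gap_L n) = gap_scale c (gap_L (m + n)) + gap_scale d (gap_C j)"
    using basis_bracket_form by blast
  have mem: "gap_scale c (gap_L (m + n)) \<in> gap_virasoro p" "gap_scale d (gap_C j) \<in> gap_virasoro p"
    unfolding gap_virasoro_def using j by (intro gap.span_scale gap.span_base; auto)+
  have "L m (L n v) - L n (L m v) = sv c (L (m + n) v) + sv d (C j v)" for v
    using act_bracket[of "gap_L m" "gap_L n" v] j
    by (simp add: br act_add_left[OF mem] act_scale_left)
  then have "L m (L n v) = L n (L m v) + sv c (L (m + n) v) + sv d (C j v)" for v
    by (metis add.commute add.assoc diff_eq_eq)
  with that j d show thesis by blast
qed

lemma C_commute:
  assumes "j \<le> p div 2"
  shows "L n (C j v) = C j (L n v)"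
  using act_bracket[of "gap_L n" "gap_C j" v] assms by simp

text \<open>Simplicity, with invariance tested on the basis of the algebra only.\<close>

lemma submodule_eq_UNIV:
  assumes W: "V.subspace W" and v: "v \<in> W" "v \<noteq> 0"
    and L: "\<And>n w. w \<in> W \<Longrightarrow> L n w \<in> W"
    and C: "\<And>j w. j \<le> p div 2 \<Longrightarrow> w \<in> W \<Longrightarrow> C j w \<in> W"
  shows "W = UNIV"
proof -
  have "act x w \<in> W" if x: "x \<in> gap_virasoro p" and w: "w \<in> W" for x w
  proof -
    let ?S = "{x \<in> gap_virasoro p. act x w \<in> W}"
    have "gap.subspace ?S"
      using W subspace_carrier unfolding gap.subspace_def V.subspace_def
      by (auto simp: act_add_left act_scale_left)
    moreover have "{gap_L m | m. True} \<union> {gap_C i | i. i \<le> p div 2} \<subseteq> ?S"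
      using L C w by auto
    ultimately have "gap.span ({gap_L m | m. True} \<union> {gap_C i | i. i \<le> p div 2}) \<subseteq> ?S"
      by (rule gap.span_minimal[rotated])
    moreover have "x \<in> gap.span ({gap_L m | m. True} \<union> {gap_C i | i. i \<le> p div 2})"
      using x by (simp only: gap_virasoro_def)
    ultimately show ?thesis by blast
  qed
  with simple[OF W] v show ?thesis by blast
qed

text \<open>
  Reduces statements about all of \<open>gap_virasoro_ge n\<close> to its basis vectors. The operator \<open>f\<close> leaves room
  for further factors to the left in a product.
\<close>

lemma act_ge_in_subspace:
  assumes W: "V.subspace W" and L: "\<And>i. i \<ge> n \<Longrightarrow> f (L i w) \<in> W"
    and f: "V.endo f" and x: "x \<in> gap_virasoro_ge n"
  shows "f (act x w) \<in> W"
proof -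
  interpret f: module_hom sv sv f by fact
  let ?S = "{x \<in> gap_virasoro p. f (act x w) \<in> W}"
  have "gap.subspace ?S"
    using W subspace_carrier unfolding gap.subspace_def V.subspace_def
    by (auto simp: act_add_left act_scale_left f.add f.scale f.zero)
  moreover have "{gap_L i | i. i \<ge> n} \<subseteq> ?S" using L by auto
  ultimately have "gap_virasoro_ge n \<subseteq> ?S"
    unfolding gap_virasoro_ge_def by (rule gap.span_minimal[rotated])
  with x show ?thesis by blast
qed

lemma gap_L_mem_ge: "i \<ge> n \<Longrightarrow> gap_L i \<in> gap_virasoro_ge n"
  unfolding gap_virasoro_ge_def by (rule gap.span_base) auto

lemma endo_foldr_act: "set xs \<subseteq> gap_virasoro p \<Longrightarrow> V.endo (foldr act xs)"
  by (induction xs) (auto intro!: V.endoI simp: module_hom.add module_hom.scale act_add_right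
      act_scale_right V.module_axioms)

section \<open>Consequences of an annihilated vector\<close>

lemma restricted_if_annihilated:
  assumes v: "v \<noteq> 0" and ann: "\<And>i. i \<ge> n \<Longrightarrow> L i v = 0"
  shows "restricted_module act"
proof -
  let ?W = "{w. \<exists>N. \<forall>k\<ge>N. L k w = 0}"
  have "?W = UNIV"
  proof (rule submodule_eq_UNIV)
    show "V.subspace ?W"
    proof (rule V.subspaceI)
      fix x y assume "x \<in> ?W" "y \<in> ?W"
      then obtain M N where "\<forall>k\<ge>M. L k x = 0" "\<forall>k\<ge>N. L k y = 0" by blast
      then have "\<forall>k\<ge>max M N. L k (x + y) = 0" by (simp add: act_add_right)
      then show "x + y \<in> ?W" by blast
    qed (auto simp: act_scale_right)
    show "v \<in> ?W" using ann by blast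
    show "L n w \<in> ?W" if w: "w \<in> ?W" for n w
    proof -
      obtain N where N: "\<forall>k\<ge>N. L k w = 0" using w by blast
      \<comment> \<open>Besides \<open>N\<close> and \<open>N - n\<close>, the bound \<open>1 - n\<close> avoids the central term at \<open>k = - n\<close>.\<close>
      have "L k (L n w) = 0" if k: "k \<ge> max N (max (N - n) (1 - n))" for k
      proof -
        obtain c d j where "k + n \<noteq> 0 \<Longrightarrow> d = 0"
          "\<And>v. L k (L n v) = L n (L k v) + sv c (L (k + n) v) + sv d (C j v)"
          using L_commutation[of k n] by metis
        then show ?thesis using k N by simp
      qed
      then show ?thesis by blast
    qed
    show "C j w \<in> ?W" if j: "j \<le> p div 2" and w: "w \<in> ?W" for j w
    proof -
      obtain N where "\<forall>k\<ge>N. L k w = 0" using w by blast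
      then have "\<forall>k\<ge>N. L k (C j w) = 0" using j by (simp add: C_commute)
      then show ?thesis by blast
    qed
  qed (fact v)
  then show ?thesis unfolding restricted_module_def by auto
qed

text \<open>
  The vectors killed by every product of \<open>N\<close> basis vectors \<open>L i\<close>, \<open>i \<ge> n\<close>, in recursive form: by
  \<open>foldr_killed\<close> below, products of \<open>N\<close> arbitrary elements of \<open>gap_virasoro_ge n\<close> kill them as well.
\<close>

primrec killed :: "int \<Rightarrow> nat \<Rightarrow> 'v set" where
  "killed n 0 = {0}"
| "killed n (Suc N) = {w. \<forall>i\<ge>n. L i w \<in> killed n N}"

lemma subspace_killed: "V.subspace (killed n N)"
  by (induction N) (auto simp: V.subspace_def act_add_right act_scale_right)

lemma killed_mono: "N \<le> M \<Longrightarrow> killed n N \<subseteq> killed n M"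
proof (rule lift_Suc_mono_le[of "killed n"])
  show "killed n N \<subseteq> killed n (Suc N)" for N
    by (induction N) auto
qed

lemma C_killed: "j \<le> p div 2 \<Longrightarrow> w \<in> killed n N \<Longrightarrow> C j w \<in> killed n N"
  by (induction N arbitrary: w) (auto simp: C_commute)

text \<open>
  Induction on the claimed number of steps. In \<open>L i (L a w) = L a (L i w) + c L (i + a) w + d C w\<close> the
  first term has a smaller \<open>N\<close>, the second a larger index \<open>i + a > a\<close>, and the central term stays
  in the same member of the filtration. For \<open>a \<ge> n\<close> applying \<open>L a\<close> already uses up one step.
\<close>

lemma L_killed:
  assumes "n > 0" "w \<in> killed n N"
  shows "L a w \<in> killed n (N + nat (n - a))"
  using assms(2)
proof (induction "N + nat (n - a)" arbitrary: N a w rule: less_induct)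
  case less
  show ?case
  proof (cases N)
    case 0
    then show ?thesis using less.prems V.subspace_0[OF subspace_killed] by simp
  next
    case (Suc N')
    show ?thesis
    proof (cases "a \<ge> n")
      case True
      then show ?thesis using less.prems killed_mono[of N' N n] by (auto simp: Suc)
    next
      case False
      then obtain s where s: "N + nat (n - a) = Suc s" and sN: "N \<le> s"
        by (cases "N + nat (n - a)") auto
      have "L i (L a w) \<in> killed n s" if i: "i \<ge> n" for i
      proof -
        obtain c d j where j: "j \<le> p div 2" and
          eq: "\<And>v. L i (L a v) = L a (L i v) + sv c (L (i + a) v) + sv d (C j v)"
          using L_commutation[of i a] by metis
        have "L i w \<in> killed n N'" using less.prems i by (simp add: Suc)
        then have "L a (L i w) \<in> killed n (N' + nat (n - a))" by (intro less.hyps) (simp add: Suc)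
        then have 1: "L a (L i w) \<in> killed n s" using s by (simp add: Suc)
        have lt: "N + nat (n - (i + a)) < N + nat (n - a)" using False i assms(1) by linarith
        then have "L (i + a) w \<in> killed n (N + nat (n - (i + a)))"
          using less.prems by (rule less.hyps)
        then have 2: "L (i + a) w \<in> killed n s"
          using killed_mono[of "N + nat (n - (i + a))" s n] lt s by auto
        have 3: "C j w \<in> killed n s"
          using C_killed[OF j less.prems] killed_mono[OF sN] by blast
        show ?thesis unfolding eq
          by (intro V.subspace_add[OF subspace_killed] V.subspace_scale[OF subspace_killed] 1 2 3)
      qed
      then show ?thesis by (simp add: s)
    qed
  qed
qed

text \<open>The filtration is exhaustive, for its union is a submodule by \<open>L_killed\<close>.\<close>

lemma killed_exhausts:
  assumes n: "n > 0" and v: "v \<noteq> 0" and ann: "\<And>i. i \<ge> n \<Longrightarrow> L i v = 0"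
  shows "\<exists>N. w \<in> killed n N"
proof -
  have "(\<Union>N. killed n N) = UNIV"
  proof (rule submodule_eq_UNIV)
    show "V.subspace (\<Union>N. killed n N)"
    proof (rule V.subspaceI)
      fix x y assume "x \<in> (\<Union>N. killed n N)" "y \<in> (\<Union>N. killed n N)"
      then obtain M N where "x \<in> killed n M" "y \<in> killed n N" by blast
      then have "x \<in> killed n (max M N)" "y \<in> killed n (max M N)"
        using killed_mono[of _ "max M N" n] by (meson max.cobounded1 max.cobounded2 subsetD)+
      then show "x + y \<in> (\<Union>N. killed n N)" using V.subspace_add[OF subspace_killed] by blast
    next
      show "0 \<in> (\<Union>N. killed n N)" using V.subspace_0[OF subspace_killed] by blast
    qed (use V.subspace_scale[OF subspace_killed] in blast)
    have "v \<in> killed n (Suc 0)" using ann by simp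
    then show "v \<in> (\<Union>N. killed n N)" by blast
    show "L a x \<in> (\<Union>N. killed n N)" if "x \<in> (\<Union>N. killed n N)" for a x
      using that L_killed[OF n] by auto
    show "C j x \<in> (\<Union>N. killed n N)" if "j \<le> p div 2" "x \<in> (\<Union>N. killed n N)" for j x
      using that C_killed[of j x n] by auto
  qed (fact v)
  then show ?thesis by blast
qed

lemma foldr_killed:
  assumes "w \<in> killed n N" "set xs \<subseteq> gap_virasoro_ge n" "length xs = N"
  shows "foldr act xs w = 0"
  using assms
proof (induction N arbitrary: w xs)
  case (Suc N)
  then obtain ys x where xs: "xs = ys @ [x]" by (metis append_butlast_last_id length_0_conv nat.distinct(1))
  have "act x w \<in> killed n N"
    by (rule act_ge_in_subspace[OF subspace_killed _ V.endo_ident]) (use Suc.prems xs in auto)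
  then show ?case using Suc.IH[of "act x w" ys] Suc.prems xs by simp
qed simp

lemma locally_nilpotent_if_annihilated:
  assumes "n > 0" "v \<noteq> 0" "\<And>i. i \<ge> n \<Longrightarrow> L i v = 0"
  shows "locally_nilpotent_module sv act (gap_virasoro_ge n)"
  unfolding locally_nilpotent_module_def
proof
  fix w
  obtain N where N: "w \<in> killed n N" using killed_exhausts[OF assms] by blast
  have "{foldr act xs w | xs. length xs = N \<and> set xs \<subseteq> gap_virasoro_ge n} \<subseteq> {0}"
    using foldr_killed[OF N] by blast
  then have "lie_pow sv act (gap_virasoro_ge n) N w \<subseteq> {0}"
    unfolding lie_pow_def using V.span_minimal[OF _ V.subspace_single_0] by blast
  then have "lie_pow sv act (gap_virasoro_ge n) N w = {0}"
    unfolding lie_pow_def using V.span_zero by blast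
  then show "\<exists>N. lie_pow sv act (gap_virasoro_ge n) N w = {0}" ..
qed

text \<open>
  In a product applied to \<open>w\<close>, the rightmost factor can be replaced by the finitely many \<open>L i\<close> that do
  not kill \<open>w\<close>, and these move \<open>w\<close> one step down the filtration.
\<close>

lemma orbit_of_killed_finite:
  assumes res: "restricted_module act" and w: "w \<in> killed n N"
  shows "\<exists>B. finite B \<and> (\<forall>xs. set xs \<subseteq> gap_virasoro_ge n \<longrightarrow> foldr act xs w \<in> V.span B)"
  using w
proof (induction N arbitrary: w)
  case 0
  have "foldr act xs 0 = 0" if "set xs \<subseteq> gap_virasoro_ge n" for xs
    using module_hom.zero[OF endo_foldr_act] that gap_virasoro_ge_subset by blast
  with 0 show ?case by (intro exI[of _ "{}"]) auto
next
  case (Suc N)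
  obtain K where K: "\<And>k. k \<ge> K \<Longrightarrow> L k w = 0" using res unfolding restricted_module_def by blast
  have "\<forall>i\<in>{n..<K}. \<exists>B. finite B \<and>
      (\<forall>xs. set xs \<subseteq> gap_virasoro_ge n \<longrightarrow> foldr act xs (L i w) \<in> V.span B)"
    using Suc by auto
  then obtain B where B: "\<And>i. i \<in> {n..<K} \<Longrightarrow> finite (B i)"
    "\<And>i xs. i \<in> {n..<K} \<Longrightarrow> set xs \<subseteq> gap_virasoro_ge n \<Longrightarrow> foldr act xs (L i w) \<in> V.span (B i)"
    by metis
  let ?B = "insert w (\<Union>i\<in>{n..<K}. B i)"
  have "foldr act xs w \<in> V.span ?B" if xs: "set xs \<subseteq> gap_virasoro_ge n" for xs
  proof (cases xs rule: rev_cases)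
    case Nil
    then show ?thesis by (simp add: V.span_base)
  next
    case (snoc ys x)
    then have ys: "set ys \<subseteq> gap_virasoro_ge n" and x: "x \<in> gap_virasoro_ge n" using xs by auto
    have endo: "V.endo (foldr act ys)" using endo_foldr_act ys gap_virasoro_ge_subset by blast
    have "foldr act ys (L i w) \<in> V.span ?B" if i: "i \<ge> n" for i
    proof (cases "i < K")
      case True
      then have "B i \<subseteq> ?B" using i by auto
      then show ?thesis using B(2)[OF _ ys, of i] V.span_mono True i by auto
    next
      case False
      then show ?thesis using K module_hom.zero[OF endo] V.span_zero by simp
    qed
    from act_ge_in_subspace[OF V.subspace_span this endo x] show ?thesis by (simp add: snoc)
  qed
  then show ?case using B(1) by (intro exI[of _ ?B]) auto
qed

lemma locally_finite_if_annihilated: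
  assumes "n > 0" "v \<noteq> 0" "\<And>i. i \<ge> n \<Longrightarrow> L i v = 0"
  shows "locally_finite_module sv act (gap_virasoro_ge n)"
  unfolding locally_finite_module_def
proof
  fix w
  obtain N where N: "w \<in> killed n N" using killed_exhausts[OF assms] by blast
  have "restricted_module act" using assms(2,3) by (rule restricted_if_annihilated)
  then obtain B where B: "finite B"
    "\<forall>xs. set xs \<subseteq> gap_virasoro_ge n \<longrightarrow> foldr act xs w \<in> V.span B"
    using orbit_of_killed_finite[OF _ N] by blast
  have "(\<Union>i. lie_pow sv act (gap_virasoro_ge n) i w) \<subseteq> V.span B"
    unfolding lie_pow_def using B(2) by (intro UN_least V.span_minimal) auto
  then show "finite_dim sv (V.span (\<Union>i. lie_pow sv act (gap_virasoro_ge n) i w))"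
    by (rule V.finite_dim_spanI[OF B(1)])
qed

section \<open>Locally nilpotent and locally finite actions\<close>

lemma funpow_in_lie_pow:
  assumes "x \<in> H"
  shows "(act x ^^ i) v \<in> lie_pow sv act H i v"
proof -
  have "(act x ^^ i) v = foldr act (replicate i x) v" by (induction i) auto
  then show ?thesis unfolding lie_pow_def
    by (intro V.span_base) (use assms in \<open>auto intro!: exI[of _ "replicate i x"]\<close>)
qed

text \<open>
  The longest products that do not kill a given nonzero vector produce annihilated vectors.
\<close>

lemma annihilated_if_locally_nilpotent:
  assumes "locally_nilpotent_module sv act H" "H \<subseteq> gap_virasoro p"
  shows "\<exists>v. v \<noteq> 0 \<and> (\<forall>x\<in>H. act x v = 0)"
proof -
  obtain v :: 'v where v: "v \<noteq> 0" using nontrivial by blast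
  define N where "N = (LEAST N. lie_pow sv act H N v = {0})"
  have "\<exists>N. lie_pow sv act H N v = {0}"
    using assms(1) unfolding locally_nilpotent_module_def by (rule spec)
  then have N: "lie_pow sv act H N v = {0}"
    unfolding N_def by (rule LeastI_ex)
  have "v \<in> lie_pow sv act H 0 v" unfolding lie_pow_def by (auto intro: V.span_base)
  with v N obtain M where M: "N = Suc M" by (metis not0_implies_Suc singletonD)
  have "lie_pow sv act H M v \<noteq> {0}"
    using not_less_Least[of M "\<lambda>N. lie_pow sv act H N v = {0}"] M unfolding N_def by simp
  then have "\<not> {foldr act xs v | xs. length xs = M \<and> set xs \<subseteq> H} \<subseteq> {0}"
    unfolding lie_pow_def using V.span_minimal[OF _ V.subspace_single_0] V.span_zero by blast
  then obtain xs where xs: "length xs = M" "set xs \<subseteq> H" "foldr act xs v \<noteq> 0" by blast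
  have "act x (foldr act xs v) = 0" if "x \<in> H" for x
  proof -
    have "foldr act (x # xs) v \<in> lie_pow sv act H N v"
      unfolding lie_pow_def by (rule V.span_base) (use xs that M in \<open>auto intro!: exI[of _ "x # xs"]\<close>)
    then show ?thesis by (simp add: N)
  qed
  with xs(3) show ?thesis by blast
qed

lemma elt_locally_nilpotent_imp_finite:
  assumes "elt_locally_nilpotent act x" "x \<in> gap_virasoro p"
  shows "elt_locally_finite sv act x"
  unfolding elt_locally_finite_def
proof
  fix v
  obtain n where n: "(act x ^^ n) v = 0" using assms(1) unfolding elt_locally_nilpotent_def by blast
  have "(act x ^^ i) v \<in> V.span ((\<lambda>i. (act x ^^ i) v) ` {..<n})" for i
  proof (cases "i < n")
    case False
    then obtain m where "i = m + n" by (metis le_add_diff_inverse2 not_less)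
    then show ?thesis
      using module_hom.zero[OF V.endo_funpow[OF endo_act[OF assms(2)]]] V.span_zero
      by (simp add: funpow_add n)
  qed (auto intro: V.span_base)
  then show "finite_dim sv (V.span {(act x ^^ i) v | i. True})"
    by (intro V.finite_dim_spanI[of "(\<lambda>i. (act x ^^ i) v) ` {..<n}"]) auto
qed

lemma algebraic_at_if_elt_locally_finite:
  assumes "elt_locally_finite sv act x"
  shows "V.algebraic_at (act x) v"
proof -
  obtain B where "finite B" "V.span B = V.span {(act x ^^ i) v | i. True}"
    using assms unfolding elt_locally_finite_def finite_dim_def by blast
  then show ?thesis by (intro V.algebraic_at_if_finite_span[of B]) (auto intro: V.span_base)
qed

section \<open>Local finiteness forces an annihilated vector\<close>

text \<open>
  The structure constant of \<open>[L q, L n]\<close> for \<open>q\<close> divisible by \<open>p\<close>, away from \<open>q + n = 0\<close>.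
\<close>

definition str_const :: "int \<Rightarrow> int \<Rightarrow> int" where
  "str_const q n = (if int p dvd n then n - q else n)"

lemma L_commutator:
  assumes "int p dvd q" "q + n \<noteq> 0"
  shows "L q (L n v) - L n (L q v) = sv (of_int (str_const q n)) (L (q + n) v)"
  using act_bracket[of "gap_L q" "gap_L n" v] assms
  by (simp add: gap_bracket_LL str_const_def act_scale_left split: if_splits)

definition str_prod :: "int \<Rightarrow> int \<Rightarrow> nat \<Rightarrow> int" where
  "str_prod q r j = (\<Prod>i<j. str_const q (r + int i * q))"

text \<open>The action of \<open>(ad (L q))\<^sup>j (L r)\<close>, as \<open>ad_orbit_Suc\<close> shows.\<close>

definition ad_orbit :: "int \<Rightarrow> int \<Rightarrow> nat \<Rightarrow> 'v \<Rightarrow> 'v" where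
  "ad_orbit q r j v = sv (of_int (str_prod q r j)) (L (r + int j * q) v)"

lemma ad_orbit_0: "ad_orbit q r 0 = L r"
  by (rule ext) (simp add: ad_orbit_def str_prod_def)

lemma ad_orbit_Suc:
  assumes "int p dvd q" "q > 0" "r > 0"
  shows "ad_orbit q r (Suc j) v = L q (ad_orbit q r j v) - ad_orbit q r j (L q v)"
proof -
  have "int j * q \<ge> 0" using assms by simp
  then have "q + (r + int j * q) \<noteq> 0" using assms by linarith
  then show ?thesis
    using L_commutator[OF assms(1), of "r + int j * q" v]
    by (simp add: ad_orbit_def str_prod_def act_scale_right V.scale_left_commute algebra_simps
        flip: V.scale_right_diff_distrib V.scale_scale)
qed

lemma str_prod_pos:
  assumes "r > q" "q > 0"
  shows "str_prod q r j > 0"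
  unfolding str_prod_def
proof (rule prod_pos)
  fix i
  have "int i * q \<ge> 0" using assms by simp
  then have "r + int i * q > q" using assms by linarith
  then show "str_const q (r + int i * q) > 0" using assms(2) by (simp add: str_const_def)
qed

text \<open>
  Two consecutive steps of length \<open>q\<close> against one of length \<open>2 * q\<close>: of the two factors on the right, one
  is at least the factor on the left because \<open>n - q \<ge> n - 2 * q\<close>, and the other one exceeds the
  number of steps taken before. The latter accounts for the factorial.
\<close>

lemma str_prod_double:
  assumes "int p dvd q" "q > 0" "r > 2 * q"
  shows "fact j * str_prod (2 * q) r j \<le> str_prod q r (2 * j)"
proof (induction j)
  case (Suc j)
  let ?n = "r + int j * (2 * q)"
  have n: "?n > 2 * q" "?n - q > int j"
  proof -
    have "int j * q \<ge> int j * 1" using assms by (intro mult_left_mono) auto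
    then show "?n > 2 * q" "?n - q > int j" using assms by (auto simp: algebra_simps)
  qed
  have dvd: "int p dvd ?n + q \<longleftrightarrow> int p dvd ?n" using assms(1) by (simp add: dvd_add_left_iff)
  have step: "int (Suc j) * str_const (2 * q) ?n \<le> str_const q (?n + q) * str_const q ?n"
    using n assms(2) unfolding str_const_def dvd by (auto intro!: mult_mono)
  have "fact (Suc j) * str_prod (2 * q) r (Suc j) =
    (fact j * str_prod (2 * q) r j) * (int (Suc j) * str_const (2 * q) ?n)"
    by (simp add: str_prod_def algebra_simps)
  also have "\<dots> \<le> str_prod q r (2 * j) * (str_const q (?n + q) * str_const q ?n)"
    using Suc step str_prod_pos[of q r "2 * j"] assms n
    by (intro mult_mono) (auto simp: str_const_def)
  also have "\<dots> = str_prod q r (2 * Suc j)"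
    by (simp add: str_prod_def algebra_simps)
  finally show ?case .
qed (simp add: str_prod_def)

text \<open>
  The comparison of growth rates. The eigenvector equation turns \<open>ad (L (2 * q))\<close> into the shifted
  operator \<open>L (2 * q) - \<mu>\<close> acting on \<open>L r w\<close>, so that local finiteness applies to it, whereas for
  \<open>L q\<close> only an upper bound on iterated commutators is required, for which \<open>w\<close> may be arbitrary.
\<close>

lemma arithmetic_progression_annihilates:
  assumes q: "int p dvd q" "q > 0" and r: "r > 2 * q"
    and fin: "elt_locally_finite sv act (gap_L q)" "elt_locally_finite sv act (gap_L (2 * q))"
    and eig: "L (2 * q) w = sv \<mu> w"
  shows "\<exists>J. \<forall>j\<ge>J. L (r + int j * (2 * q)) w = 0"
proof -
  let ?B = "\<lambda>v. L (2 * q) v - sv \<mu> v"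
  have B: "V.endo ?B"
    by (rule V.endoI) (simp_all add: act_add_right act_scale_right V.scale_right_distrib
        V.scale_right_diff_distrib mult.commute)
  have orbit: "(?B ^^ j) (L r w) = ad_orbit (2 * q) r j w" for j
  proof (induction j)
    case (Suc j)
    have "ad_orbit (2 * q) r (Suc j) w =
      L (2 * q) (ad_orbit (2 * q) r j w) - ad_orbit (2 * q) r j (sv \<mu> w)"
      using ad_orbit_Suc[of "2 * q" r j w] q r eig by simp
    also have "ad_orbit (2 * q) r j (sv \<mu> w) = sv \<mu> (ad_orbit (2 * q) r j w)"
      by (simp add: ad_orbit_def act_scale_right mult.commute)
    finally show ?case using Suc by simp
  qed (simp add: ad_orbit_0)
  have "\<exists>n. (?B ^^ n) (L r w) = 0"
  proof (rule V.nilpotent_if_factorial_decay[OF B])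
    show "V.algebraic_at ?B (L r w)"
      by (intro V.algebraic_at_shift endo_act algebraic_at_if_elt_locally_finite fin gap_L_mem)
    fix \<phi> assume \<phi>: "V.functional \<phi>"
    interpret \<phi>: module_hom sv "(*)" \<phi> by fact
    obtain K Q where K: "K \<ge> 0" and bound: "\<And>j. cmod (\<phi> (ad_orbit q r j w)) \<le> K * Q ^ j"
    proof (rule V.iterated_commutator_growth[of "L q" "ad_orbit q r" \<phi> w])
      show "ad_orbit q r (Suc j) v = L q (ad_orbit q r j v) - ad_orbit q r j (L q v)" for j v
        using ad_orbit_Suc q r by simp
    qed (use \<phi> endo_act algebraic_at_if_elt_locally_finite fin in \<open>auto simp: ad_orbit_0\<close>)
    have "fact j * cmod (\<phi> ((?B ^^ j) (L r w))) \<le> K * (Q ^ 2) ^ j" for j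
    proof -
      let ?u = "L (r + int j * (2 * q)) w"
      have norm_orbit: "cmod (\<phi> (sv (of_int c) ?u)) = of_int c * cmod (\<phi> ?u)" if "c > 0" for c
        using that by (simp add: \<phi>.scale norm_mult)
      have "fact j * cmod (\<phi> ((?B ^^ j) (L r w))) =
        of_int (fact j * str_prod (2 * q) r j) * cmod (\<phi> ?u)"
        unfolding orbit ad_orbit_def using str_prod_pos[of "2 * q" r j] q r
        by (simp add: norm_orbit)
      also have "\<dots> \<le> of_int (str_prod q r (2 * j)) * cmod (\<phi> ?u)"
        using str_prod_double[OF q r, of j] by (intro mult_right_mono) (simp_all only: of_int_le_iff norm_ge_zero)
      also have "\<dots> = cmod (\<phi> (ad_orbit q r (2 * j) w))"
        unfolding ad_orbit_def using str_prod_pos[of q r "2 * j"] q r norm_orbit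
        by (simp add: mult_ac)
      also have "\<dots> \<le> K * Q ^ (2 * j)" by (rule bound)
      finally show ?thesis by (simp add: power_mult)
    qed
    with K show "\<exists>C\<ge>0. \<exists>Q. \<forall>j. fact j * cmod (\<phi> ((?B ^^ j) (L r w))) \<le> C * Q ^ j" by blast
  qed
  then obtain J where J: "(?B ^^ J) (L r w) = 0" ..
  have "L (r + int j * (2 * q)) w = 0" if "j \<ge> J" for j
  proof -
    have "(?B ^^ j) (L r w) = (?B ^^ (j - J)) ((?B ^^ J) (L r w))"
      using that funpow_add[of "j - J" J ?B] by simp
    also have "\<dots> = 0" using J module_hom.zero[OF V.endo_funpow[OF B]] by simp
    finally show ?thesis
      using str_prod_pos[of "2 * q" r j] q r by (simp add: orbit ad_orbit_def)
  qed
  then show ?thesis by blast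
qed

text \<open>
  The half-open interval \<open>{2 * q<..4 * q}\<close> is a set of representatives modulo \<open>2 * q\<close> lying in
  the range in which the growth argument applies.
\<close>

lemma annihilated_if_locally_finite:
  assumes k: "k > 0" and fin: "\<And>i. i \<ge> k \<Longrightarrow> elt_locally_finite sv act (gap_L i)"
  shows "\<exists>n v. n > 0 \<and> v \<noteq> 0 \<and> (\<forall>i\<ge>n. L i v = 0)"
proof -
  define q where "q = int p * k"
  have "q \<ge> 1 * k" unfolding q_def using p_pos k by (intro mult_right_mono) auto
  then have q: "int p dvd q" "q > 0" "q \<ge> k" unfolding q_def using k p_pos by auto
  have finq: "elt_locally_finite sv act (gap_L q)" "elt_locally_finite sv act (gap_L (2 * q))"
    using fin q by auto
  obtain v :: 'v where "v \<noteq> 0" using nontrivial by blast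
  then obtain P where "P \<noteq> 0" "V.poly_apply (L (2 * q)) P v = 0"
    using algebraic_at_if_elt_locally_finite[OF finq(2), of v] by (auto simp: V.algebraic_at_def)
  then obtain w \<mu> where w: "w \<noteq> 0" "L (2 * q) w = sv \<mu> w"
    using V.eigenvector_at_root[OF endo_act[OF gap_L_mem] _ _ \<open>v \<noteq> 0\<close>] by metis
  have "\<exists>J. \<forall>j\<ge>J. L (r + int j * (2 * q)) w = 0" if "r \<in> {2 * q<..4 * q}" for r
    using arithmetic_progression_annihilates[OF q(1,2) _ finq w(2)] that by simp
  then obtain J where J: "\<And>r j. r \<in> {2 * q<..4 * q} \<Longrightarrow> j \<ge> J r \<Longrightarrow> L (r + int j * (2 * q)) w = 0"
    by metis
  define M where "M = Max (J ` {2 * q<..4 * q})"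
  have "L i w = 0" if i: "i \<ge> 4 * q + int M * (2 * q) + 1" for i
  proof -
    define j where "j = nat ((i - 2 * q - 1) div (2 * q))"
    define r where "r = (i - 2 * q - 1) mod (2 * q) + 2 * q + 1"
    have "0 \<le> int M * (2 * q)" using q by simp
    then have "i - 2 * q - 1 \<ge> 0" using i q by linarith
    then have "(i - 2 * q - 1) div (2 * q) \<ge> 0" using q by (simp add: pos_imp_zdiv_nonneg_iff)
    then have j: "int j = (i - 2 * q - 1) div (2 * q)" unfolding j_def by simp
    have eq: "i = r + int j * (2 * q)" unfolding r_def j
      using div_mult_mod_eq[of "i - 2 * q - 1" "2 * q"] by linarith
    have "0 < 2 * q" using q by simp
    from pos_mod_sign[OF this] pos_mod_bound[OF this]
    have "0 \<le> (i - 2 * q - 1) mod (2 * q)" "(i - 2 * q - 1) mod (2 * q) < 2 * q" .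
    then have r: "r \<in> {2 * q<..4 * q}" unfolding r_def greaterThanAtMost_iff by linarith
    have "int M * (2 * q) < int j * (2 * q)"
      using i eq r unfolding greaterThanAtMost_iff by linarith
    then have "M \<le> j" using q by simp
    moreover have "J r \<le> M" unfolding M_def using r by (intro Max_ge) auto
    ultimately show ?thesis using J[OF r, of j] eq by simp
  qed
  moreover have "4 * q + int M * (2 * q) + 1 > 0" using q by (simp add: add_pos_nonneg)
  ultimately show ?thesis using w(1) by blast
qed

end

section \<open>The equivalence\<close>

theorem theorem4p2:
  fixes p :: nat
    and sv :: "complex \<Rightarrow> 'v::ab_group_add \<Rightarrow> 'v"
    and act :: "gap_space \<Rightarrow> 'v \<Rightarrow> 'v"
  assumes "p \<ge> 2"
    and "simple_lie_module gap_scale (gap_virasoro p) (gap_bracket p) sv act"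
  shows
    "((\<exists>k::int. k > 0 \<and> (\<forall>i\<ge>k. elt_locally_finite sv act (gap_L i)))
      \<longleftrightarrow> (\<exists>k::int. k > 0 \<and> (\<forall>i\<ge>k. elt_locally_nilpotent act (gap_L i)))) \<and>
     ((\<exists>k::int. k > 0 \<and> (\<forall>i\<ge>k. elt_locally_nilpotent act (gap_L i)))
      \<longleftrightarrow> (\<exists>n::int. n > 0 \<and> locally_finite_module sv act (gap_virasoro_ge n))) \<and>
     ((\<exists>n::int. n > 0 \<and> locally_finite_module sv act (gap_virasoro_ge n))
      \<longleftrightarrow> (\<exists>n::int. n > 0 \<and> locally_nilpotent_module sv act (gap_virasoro_ge n))) \<and>
     ((\<exists>n::int. n > 0 \<and> locally_nilpotent_module sv act (gap_virasoro_ge n))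
      \<longleftrightarrow> (\<exists>n::int. n > 0 \<and> (\<exists>v. v \<noteq> 0 \<and> (\<forall>x\<in>gap_virasoro_ge n. act x v = 0)))) \<and>
     ((\<exists>n::int. n > 0 \<and> (\<exists>v. v \<noteq> 0 \<and> (\<forall>x\<in>gap_virasoro_ge n. act x v = 0)))
      \<longleftrightarrow> restricted_module act)"
    (is "(?s1 \<longleftrightarrow> ?s2) \<and> (?s2 \<longleftrightarrow> ?s3) \<and> (?s3 \<longleftrightarrow> ?s4) \<and> (?s4 \<longleftrightarrow> ?s5) \<and> (?s5 \<longleftrightarrow> ?s6)")
proof -
  interpret simple_lie_module gap_scale "gap_virasoro p" "gap_bracket p" sv act by fact
  interpret simple_gap_module p sv act using assms(1) by unfold_locales simp
  have ann: "\<forall>x\<in>gap_virasoro_ge n. act x v = 0" if "\<forall>i\<ge>n. L i v = 0" for n v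
  proof
    fix x assume "x \<in> gap_virasoro_ge n"
    then have "act x v \<in> {0}"
      by (rule act_ge_in_subspace[OF V.subspace_single_0 _ V.endo_ident, rotated]) (use that in auto)
    then show "act x v = 0" by simp
  qed
  have "?s1 \<Longrightarrow> ?s5"
    using annihilated_if_locally_finite ann by metis
  moreover have "?s5 \<Longrightarrow> ?s6"
    using restricted_if_annihilated gap_L_mem_ge by metis
  moreover have "?s6 \<Longrightarrow> ?s3 \<and> ?s4"
  proof -
    assume s6: ?s6
    obtain v :: 'v where v: "v \<noteq> 0" using nontrivial by blast
    with s6 obtain N where N: "\<And>i. i \<ge> N \<Longrightarrow> L i v = 0" unfolding restricted_module_def by blast
    have "max N 1 > 0" "\<And>i. i \<ge> max N 1 \<Longrightarrow> L i v = 0" using N by auto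
    with locally_finite_if_annihilated[OF _ v] locally_nilpotent_if_annihilated[OF _ v]
    show ?thesis by blast
  qed
  moreover have "?s4 \<Longrightarrow> ?s5"
    using annihilated_if_locally_nilpotent gap_virasoro_ge_subset by metis
  moreover have "?s4 \<Longrightarrow> ?s2"
    unfolding locally_nilpotent_module_def elt_locally_nilpotent_def
    using funpow_in_lie_pow[OF gap_L_mem_ge] by (metis singletonD)
  moreover have "?s2 \<Longrightarrow> ?s1"
    using elt_locally_nilpotent_imp_finite by auto
  moreover have "?s3 \<Longrightarrow> ?s1"
  proof -
    assume ?s3
    then obtain n :: int where n: "n > 0" "locally_finite_module sv act (gap_virasoro_ge n)" by blast
    have "elt_locally_finite sv act (gap_L i)" if i: "i \<ge> n" for i
      unfolding elt_locally_finite_def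
    proof
      fix v
      obtain B where B: "finite B" "V.span B = V.span (\<Union>i. lie_pow sv act (gap_virasoro_ge n) i v)"
        using n(2) unfolding locally_finite_module_def finite_dim_def by blast
      have "{(act (gap_L i) ^^ j) v | j. True} \<subseteq> V.span B"
        unfolding B(2) using funpow_in_lie_pow[OF gap_L_mem_ge[OF i]] by (auto intro!: V.span_base)
      then show "finite_dim sv (V.span {(act (gap_L i) ^^ j) v | j. True})"
        by (rule V.finite_dim_spanI[OF B(1)])
    qed
    with n(1) show ?s1 by blast
  qed
  ultimately show ?thesis by argo
qed

end
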